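(* Let $T>0$, $K>0$ and consider the European put option, $g(s)=(K-s)_+$, with discrete replicating portfolio $(a_m(t_k,x),b_m(t_k,x))$, discrete price $P_m$ and smooth approximation $P_m^{(n)}$ of the price. Then the smooth approximation can be used to find an approximate replicating portfolio, as follows. (a) For any $T-t_k\ge\delta>0$, $x>0$, and $m\ge m_0$, $n=\lceil2^{2m/3}\rceil$ such that $\frac1K\left(\frac1n+c_12^{-m}\right)\le\frac12$, with the positive constants $c_1,c_3,c_5,c_6$ specified in the context, we have $$\left|a_m(t_k,x)-\partial_xP_m^{(n)}(t_{k+1},x)\right|\le\left(2c_3x+\frac{c_5+c_6}{2\sigma x\sqrt\delta}\right)2^{-m/3}$$ and $$\left|b_m(t_k,x)-r_m^{-k-1}\left(P_m(t_{k+1},u_mx)-u_mx\,\partial_xP_m^{(n)}(t_{k+1},x)\right)\right|\le(1+\sigma2^{-m}+|\mu|2^{-2m})\left(2c_3x^2+\frac{c_5+c_6}{2\sigma\sqrt\delta}\right)2^{-m/3}.$$ (b) Moreover, using the notation $t^{(m)}=\lfloor t2^{2m}\rfloor2^{-2m}$, almost surely $$\lim_{m\to\infty}\sup_{0\le t\le T}|a_m(t^{(m)})-a(t)|=0,\qquad\lim_{m\to\infty}\sup_{0\le t\le T}|b_m(t^{(m)})-b(t)|=0,$$ where $(a(t),b(t))$ is the replicating portfolio of the Black--Scholes model.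
   Context: Fixed parameters: $\mu\in\mathbb{R}$, $\sigma>0$, $r>0$, $s_0>0$; $z_+=\max(z,0)$; $m$ is a nonnegative integer. Random walks $B_m$ and Brownian motion $B$ (``twist and shrink''). Let $X_m(k)$ ($m\ge0$, $k\ge1$) be i.i.d. with $\mathbb{P}(X_m(k)=\pm1)=\frac12$ on a complete probability space $(\Omega,\mathcal F,\mathbb{P})$, and let $Y_m(n)=\sum_{k=1}^nX_m(k)$, $Y_m(0)=0$. For $m\ge1$ let $T_m(0)=0$, $T_m(k+1)=\min\{n>T_m(k):|Y_m(n)-Y_m(T_m(k))|=2\}$. Put $\widetilde X_0=X_0$, and recursively for $m\ge1$ and $T_m(k)<n\le T_m(k+1)$ put $\widetilde X_m(n)=X_m(n)$ if $Y_m(T_m(k+1))-Y_m(T_m(k))=2\widetilde X_{m-1}(k+1)$, and $\widetilde X_m(n)=-X_m(n)$ otherwise. Let $\widetilde Y_m(n)=\sum_{j\le n}\widetilde X_m(j)$, extended to real times by linear interpolation, and $B_m(t)=2^{-m}\widetilde Y_m(t2^{2m})$. It is known that each $\widetilde Y_m$ is a simple symmetric random walk and that $B_m$ converges a.s., uniformly on bounded intervals, to a Brownian motion $B$. Discrete model. $\Delta t=2^{-2m}$, $t_k=k\Delta t$ ($k=0,1,2,\dots$); in (a) $T=N\Delta t$ with $N$ an integer, and in general $N=\lfloor T2^{2m}\rfloor$; $r_m=1+r2^{-2m}$, $u_m=1+\sigma2^{-m}+\mu2^{-2m}$, $d_m=1-\sigma2^{-m}+\mu2^{-2m}$, $q_m^\pm=\frac12\pm\frac12\frac{r-\mu}{\sigma}2^{-m}$,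 $m_0=\frac1{\log2}\log\frac{|r-\mu|}{\sigma}$. The stock price is $S_m(0)=s_0$, $S_m(t_{k+1})=S_m(t_k)\{1+\mu\Delta t+\sigma(B_m(t_{k+1})-B_m(t_k))\}$. For a function $h$ write $$F_m[h](t_k,x)=r_m^{k-N}\sum_{i=0}^{N-k}\binom{N-k}{i}(q_m^+)^i(q_m^-)^{N-k-i}h(xu_m^id_m^{N-k-i}).$$ The discrete put price is $P_m:=F_m[g]$ and its smooth approximation is $P_m^{(n)}:=F_m[g_n]$, where $g_n(s)=\int_{-\infty}^\infty g(s-u)\,n\psi(nu)\,du$, $\psi(u)=c\exp(-1/(1-u^2))$ for $|u|<1$, $\psi(u)=0$ for $|u|\ge1$, with $c$ such that $\int\psi=1$. The discrete replicating portfolio (held on $[t_k,t_{k+1})$) is $$a_m(t_k,x)=\frac{P_m(t_{k+1},u_mx)-P_m(t_{k+1},d_mx)}{(u_m-d_m)x},\qquad b_m(t_k,x)=r_m^{-k-1}\left(P_m(t_{k+1},u_mx)-a_m(t_k,x)u_mx\right),$$ and $a_m(t_k):=a_m(t_k,S_m(t_k))$, $b_m(t_k):=b_m(t_k,S_m(t_k))$. Constants (taken from earlier results of the paper). $c_1=c_1(\mu,\sigma,T)$ is the constant in the bound $\sup_{0\le t_k\le T}|S_m(t_k)-\widetilde S_m(t_k)|\le c_12^{-m}$ for all $m\ge0$, where $\widetilde S_m(t)=s_0\exp((\mu-\sigma^2/2)t+\sigma B_m(t))$. $c_3=c_3(\mu,\sigma,r,T)$ is the constant such that for every $h\in C^2_c(\mathbb{R}_+)$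 with $M=\sup_{s\ge0}|h''(s)|$, writing $f_m=F_m[h]$, one has $\left|\frac{f_m(t_{k+1},u_mx)-f_m(t_{k+1},d_mx)}{(u_m-d_m)x}-\partial_xf_m(t_{k+1},x)\right|\le c_3Mx2^{-m}$. $c_5,c_6$, depending on $\mu,\sigma,r,T,K$, are the positive constants in the bound $\mathbb{Q}_m^x(|S_m(T-t_k)-K|\le\frac1n)\le\frac{c_5}{\sqrt\delta}\frac1n+\frac{c_6}{\sqrt\delta}2^{-m}$, valid for $T-t_k\ge\delta>0$, $x>0$, $m\ge m_0$, $n\ge1$ with $\frac1K(\frac1n+c_12^{-m})\le\frac12$; here under $\mathbb{Q}_m^x$ the price process starts at $x$ and its successive ratios are independent, equal to $u_m$ or $d_m$ with probabilities $q_m^+$, $q_m^-$. Black--Scholes model. $S(t)=s_0\exp((\mu-\sigma^2/2)t+\sigma B(t))$; $P(t,x)=e^{-r(T-t)}\mathbb{E}[(K-xe^{(r-\sigma^2/2)(T-t)+\sigma W(T-t)})_+]$ with $W$ a standard Brownian motion; $a(t)=\partial_xP(t,S(t))$, $b(t)=e^{-rt}\{P(t,S(t))-S(t)\partial_xP(t,S(t))\}$, with the convention $g'(K)=-\frac12$.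
   Formalization: In (a) and in the bound defining c_3, m is restricted to d_m ≥ 0, since F_m[h] for h on [0,∞) is otherwise undefined; c_1 may depend on the path, as no deterministic c_1 exists; P_m(t_{N+1},·), used at the last date t_N, is taken to be the payoff g. *)

theory Defs
  imports "HOL-Probability.Probability"
begin

definition standard_BM :: "'a measure \<Rightarrow> (real \<Rightarrow> 'a \<Rightarrow> real) \<Rightarrow> bool" where
  "standard_BM M W \<longleftrightarrow> prob_space M
     \<and> (\<forall>t\<ge>0. W t \<in> borel_measurable M)
     \<and> (AE \<omega> in M. W 0 \<omega> = 0)
     \<and> (\<forall>s t. 0 \<le> s \<and> s < t \<longrightarrow>
          distributed M lborel (\<lambda>\<omega>. W t \<omega> - W s \<omega>) (normal_density 0 (sqrt (t - s))))
     \<and> (\<forall>(n::nat) \<tau>. 0 \<le> \<tau> 0 \<and> (\<forall>i<n. \<tau> i \<le> \<tau> (Suc i)) \<longrightarrow>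
          prob_space.indep_vars M (\<lambda>_. borel) (\<lambda>i \<omega>. W (\<tau> (Suc i)) \<omega> - W (\<tau> i) \<omega>) {..<n})
     \<and> (AE \<omega> in M. continuous_on {0..} (\<lambda>t. W t \<omega>))"

text \<open>The construction is pathwise: \<open>x m k\<close> (used for \<open>k \<ge> 1\<close>) stands for the value
  of \<open>X\<^sub>m(k)\<close> at a fixed sample point.\<close>

definition walk :: "(nat \<Rightarrow> real) \<Rightarrow> nat \<Rightarrow> real" where
  "walk x n = (\<Sum>k=1..n. x k)"

text \<open>Almost surely all the sets below are nonempty; on the exceptional null set the
  least element has no particular meaning.\<close>

primrec stop_time :: "(nat \<Rightarrow> real) \<Rightarrow> nat \<Rightarrow> nat" where
  "stop_time y 0 = 0"
| "stop_time y (Suc k) =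
     (LEAST n. stop_time y k < n \<and> \<bar>y n - y (stop_time y k)\<bar> = 2)"

primrec twisted :: "(nat \<Rightarrow> nat \<Rightarrow> real) \<Rightarrow> nat \<Rightarrow> nat \<Rightarrow> real" where
  "twisted x 0 = x 0"
| "twisted x (Suc m) = (\<lambda>n.
     let y = walk (x (Suc m)); \<tau> = stop_time y;
         k = (THE k. \<tau> k < n \<and> n \<le> \<tau> (Suc k))
     in if y (\<tau> (Suc k)) - y (\<tau> k) = 2 * twisted x m (Suc k)
        then x (Suc m) n else - x (Suc m) n)"

definition lin_interp :: "(nat \<Rightarrow> real) \<Rightarrow> real \<Rightarrow> real" where
  "lin_interp y s = (let n = nat \<lfloor>s\<rfloor> in y n + (s - real n) * (y (Suc n) - y n))"

definition BM_approx :: "(nat \<Rightarrow> nat \<Rightarrow> real) \<Rightarrow> nat \<Rightarrow> real \<Rightarrow> real" where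
  "BM_approx x m t = lin_interp (walk (twisted x m)) (t * 2 ^ (2 * m)) / 2 ^ m"

definition grid :: "nat \<Rightarrow> nat \<Rightarrow> real" where
  "grid m k = real k / 2 ^ (2 * m)"

definition steps :: "real \<Rightarrow> nat \<Rightarrow> nat" where
  "steps T m = nat \<lfloor>T * 2 ^ (2 * m)\<rfloor>"

definition rate :: "real \<Rightarrow> nat \<Rightarrow> real" where
  "rate r m = 1 + r / 2 ^ (2 * m)"

definition up :: "real \<Rightarrow> real \<Rightarrow> nat \<Rightarrow> real" where
  "up \<mu> \<sigma> m = 1 + \<sigma> / 2 ^ m + \<mu> / 2 ^ (2 * m)"

definition down :: "real \<Rightarrow> real \<Rightarrow> nat \<Rightarrow> real" where
  "down \<mu> \<sigma> m = 1 - \<sigma> / 2 ^ m + \<mu> / 2 ^ (2 * m)"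

definition q_up :: "real \<Rightarrow> real \<Rightarrow> real \<Rightarrow> nat \<Rightarrow> real" where
  "q_up \<mu> \<sigma> r m = 1/2 + 1/2 * ((r - \<mu>) / \<sigma>) / 2 ^ m"

definition q_down :: "real \<Rightarrow> real \<Rightarrow> real \<Rightarrow> nat \<Rightarrow> real" where
  "q_down \<mu> \<sigma> r m = 1/2 - 1/2 * ((r - \<mu>) / \<sigma>) / 2 ^ m"

text \<open>If \<open>r = \<mu>\<close> then the threshold is minus infinity; the value 0 resulting from
  \<open>ln 0 = 0\<close> imposes the same (void) condition on natural numbers.\<close>

definition m_zero :: "real \<Rightarrow> real \<Rightarrow> real \<Rightarrow> real" where
  "m_zero \<mu> \<sigma> r = 1 / ln 2 * ln (\<bar>r - \<mu>\<bar> / \<sigma>)"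

primrec stock :: "real \<Rightarrow> real \<Rightarrow> real \<Rightarrow> (nat \<Rightarrow> nat \<Rightarrow> real) \<Rightarrow> nat \<Rightarrow> nat \<Rightarrow> real" where
  "stock \<mu> \<sigma> s0 x m 0 = s0"
| "stock \<mu> \<sigma> s0 x m (Suc k) = stock \<mu> \<sigma> s0 x m k *
     (1 + \<mu> / 2 ^ (2 * m) + \<sigma> * (BM_approx x m (grid m (Suc k)) - BM_approx x m (grid m k)))"

definition stock_exp :: "real \<Rightarrow> real \<Rightarrow> real \<Rightarrow> (nat \<Rightarrow> nat \<Rightarrow> real) \<Rightarrow> nat \<Rightarrow> real \<Rightarrow> real" where
  "stock_exp \<mu> \<sigma> s0 x m t = s0 * exp ((\<mu> - \<sigma>\<^sup>2 / 2) * t + \<sigma> * BM_approx x m t)"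

text \<open>\<open>F_disc \<mu> \<sigma> r T m h k x\<close> is \<open>F\<^sub>m[h](t\<^sub>k, x)\<close>. The subtraction
  \<open>N - k\<close> is truncated, so that \<open>F\<^sub>m[h](t\<^sub>k, \<cdot>) = h\<close> for all \<open>k \<ge> N\<close>. The value at
  \<open>k = N + 1\<close> enters the portfolio at \<open>t\<^sub>N\<close>, hence at all times in \<open>[t\<^sub>N, T]\<close>;
  the sum itself is meaningful for \<open>k \<le> N\<close> only.\<close>

definition F_disc ::
  "real \<Rightarrow> real \<Rightarrow> real \<Rightarrow> real \<Rightarrow> nat \<Rightarrow> (real \<Rightarrow> real) \<Rightarrow> nat \<Rightarrow> real \<Rightarrow> real" where
  "F_disc \<mu> \<sigma> r T m h k x =
     (let j = steps T m - k in
        (\<Sum>i=0..j. real (j choose i) * q_up \<mu> \<sigma> r m ^ i * q_down \<mu> \<sigma> r m ^ (j - i)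
             * h (x * up \<mu> \<sigma> m ^ i * down \<mu> \<sigma> m ^ (j - i))) / rate r m ^ j)"

definition put :: "real \<Rightarrow> real \<Rightarrow> real" where
  "put K s = max (K - s) 0"

definition bump :: "real \<Rightarrow> real" where
  "bump u = (if \<bar>u\<bar> < 1 then exp (- 1 / (1 - u\<^sup>2)) else 0)"

definition mollifier :: "real \<Rightarrow> real" where
  "mollifier u = bump u / (LINT v|lborel. bump v)"

definition smooth :: "nat \<Rightarrow> (real \<Rightarrow> real) \<Rightarrow> real \<Rightarrow> real" where
  "smooth n h s = (LINT u|lborel. h (s - u) * (real n * mollifier (real n * u)))"

definition P_disc :: "real \<Rightarrow> real \<Rightarrow> real \<Rightarrow> real \<Rightarrow> real \<Rightarrow> nat \<Rightarrow> nat \<Rightarrow> real \<Rightarrow> real" where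
  "P_disc \<mu> \<sigma> r T K m = F_disc \<mu> \<sigma> r T m (put K)"

definition P_smooth ::
  "real \<Rightarrow> real \<Rightarrow> real \<Rightarrow> real \<Rightarrow> real \<Rightarrow> nat \<Rightarrow> nat \<Rightarrow> nat \<Rightarrow> real \<Rightarrow> real" where
  "P_smooth \<mu> \<sigma> r T K m n = F_disc \<mu> \<sigma> r T m (smooth n (put K))"

definition diff_quot :: "real \<Rightarrow> real \<Rightarrow> nat \<Rightarrow> (real \<Rightarrow> real) \<Rightarrow> real \<Rightarrow> real" where
  "diff_quot \<mu> \<sigma> m f x =
     (f (up \<mu> \<sigma> m * x) - f (down \<mu> \<sigma> m * x)) / ((up \<mu> \<sigma> m - down \<mu> \<sigma> m) * x)"

definition a_disc :: "real \<Rightarrow> real \<Rightarrow> real \<Rightarrow> real \<Rightarrow> real \<Rightarrow> nat \<Rightarrow> nat \<Rightarrow> real \<Rightarrow> real" where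
  "a_disc \<mu> \<sigma> r T K m k x = diff_quot \<mu> \<sigma> m (P_disc \<mu> \<sigma> r T K m (Suc k)) x"

definition b_disc :: "real \<Rightarrow> real \<Rightarrow> real \<Rightarrow> real \<Rightarrow> real \<Rightarrow> nat \<Rightarrow> nat \<Rightarrow> real \<Rightarrow> real" where
  "b_disc \<mu> \<sigma> r T K m k x =
     (P_disc \<mu> \<sigma> r T K m (Suc k) (up \<mu> \<sigma> m * x)
        - a_disc \<mu> \<sigma> r T K m k x * (up \<mu> \<sigma> m * x)) / rate r m ^ Suc k"

text \<open>The processes \<open>a\<^sub>m(t\<^sup>(\<^sup>m\<^sup>))\<close> and \<open>b\<^sub>m(t\<^sup>(\<^sup>m\<^sup>))\<close>; the index of the grid point
  \<open>t\<^sup>(\<^sup>m\<^sup>)\<close> is \<open>steps t m\<close>.\<close>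

definition a_path ::
  "real \<Rightarrow> real \<Rightarrow> real \<Rightarrow> real \<Rightarrow> real \<Rightarrow> real \<Rightarrow> (nat \<Rightarrow> nat \<Rightarrow> real) \<Rightarrow> nat \<Rightarrow> real \<Rightarrow> real" where
  "a_path \<mu> \<sigma> r s0 T K x m t =
     a_disc \<mu> \<sigma> r T K m (steps t m) (stock \<mu> \<sigma> s0 x m (steps t m))"

definition b_path ::
  "real \<Rightarrow> real \<Rightarrow> real \<Rightarrow> real \<Rightarrow> real \<Rightarrow> real \<Rightarrow> (nat \<Rightarrow> nat \<Rightarrow> real) \<Rightarrow> nat \<Rightarrow> real \<Rightarrow> real" where
  "b_path \<mu> \<sigma> r s0 T K x m t =
     b_disc \<mu> \<sigma> r T K m (steps t m) (stock \<mu> \<sigma> s0 x m (steps t m))"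

text \<open>Law of the price after \<open>j\<close> steps under \<open>\<bbbQ>\<^sub>m\<^sup>x\<close>: a product of \<open>x\<close> with
  \<open>j\<close> independent ratios. The Bernoulli parameter lies in \<open>[0, 1]\<close> iff
  \<open>m \<ge> m_zero \<mu> \<sigma> r\<close>.\<close>

definition Q_law :: "real \<Rightarrow> real \<Rightarrow> real \<Rightarrow> nat \<Rightarrow> real \<Rightarrow> nat \<Rightarrow> real pmf" where
  "Q_law \<mu> \<sigma> r m x j =
     map_pmf (\<lambda>\<epsilon>. x * (\<Prod>i<j. if \<epsilon> i then up \<mu> \<sigma> m else down \<mu> \<sigma> m))
       (Pi_pmf {..<j} False (\<lambda>_. bernoulli_pmf (q_up \<mu> \<sigma> r m)))"

text \<open>The bound defining \<open>c\<^sub>1\<close> is a pathwise one, and the constant depends on the path: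
  since all first \<open>N\<close> steps of \<open>B\<^sub>m\<close> are upward with positive probability, no number
  satisfies it for almost all paths simultaneously.\<close>

definition is_c1 :: "real \<Rightarrow> real \<Rightarrow> real \<Rightarrow> real \<Rightarrow> (nat \<Rightarrow> nat \<Rightarrow> real) \<Rightarrow> real \<Rightarrow> bool" where
  "is_c1 \<mu> \<sigma> s0 T x c1 \<longleftrightarrow> 0 < c1 \<and>
     (\<forall>m k. grid m k \<le> T \<longrightarrow>
        \<bar>stock \<mu> \<sigma> s0 x m k - stock_exp \<mu> \<sigma> s0 x m (grid m k)\<bar> \<le> c1 / 2 ^ m)"

text \<open>\<open>h \<in> C\<^sub>c\<^sup>2([0, \<infinity>))\<close> with second derivative \<open>h2\<close>, one-sided at 0. The values of
  \<open>h\<close> at negative arguments are irrelevant, and \<open>h\<close> need not vanish at 0.\<close>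

definition C2c :: "(real \<Rightarrow> real) \<Rightarrow> (real \<Rightarrow> real) \<Rightarrow> bool" where
  "C2c h h2 \<longleftrightarrow>
     (\<exists>h1. \<forall>s\<ge>0. (h has_real_derivative h1 s) (at s within {0..})
                \<and> (h1 has_real_derivative h2 s) (at s within {0..}))
     \<and> continuous_on {0..} h2
     \<and> (\<exists>R. \<forall>s\<ge>R. h s = 0)"

text \<open>\<open>F\<^sub>m[h]\<close> makes sense for a function \<open>h\<close> on \<open>[0, \<infinity>)\<close> only if
  \<open>0 \<le> down \<mu> \<sigma> m\<close> (then also \<open>0 < up \<mu> \<sigma> m\<close>); this holds for all large \<open>m\<close>.\<close>

definition is_c3 :: "real \<Rightarrow> real \<Rightarrow> real \<Rightarrow> real \<Rightarrow> real \<Rightarrow> bool" where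
  "is_c3 \<mu> \<sigma> r T c3 \<longleftrightarrow> 0 < c3 \<and>
     (\<forall>h h2 m k x. C2c h h2 \<and> m_zero \<mu> \<sigma> r \<le> real m \<and> 0 \<le> down \<mu> \<sigma> m
          \<and> grid m (Suc k) \<le> T \<and> 0 < x \<longrightarrow>
        \<bar>diff_quot \<mu> \<sigma> m (F_disc \<mu> \<sigma> r T m h (Suc k)) x
           - deriv (F_disc \<mu> \<sigma> r T m h (Suc k)) x\<bar>
          \<le> c3 * (SUP s\<in>{0..}. \<bar>h2 s\<bar>) * x / 2 ^ m)"

text \<open>\<open>S\<^sub>m(T - t\<^sub>k)\<close> is the price after \<open>N - k\<close> steps, given that \<open>T = t\<^sub>N\<close>.\<close>

definition is_c5_c6 ::
  "real \<Rightarrow> real \<Rightarrow> real \<Rightarrow> real \<Rightarrow> real \<Rightarrow> real \<Rightarrow> real \<Rightarrow> real \<Rightarrow> bool" where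
  "is_c5_c6 \<mu> \<sigma> r T K c1 c5 c6 \<longleftrightarrow> 0 < c5 \<and> 0 < c6 \<and>
     (\<forall>\<delta> m k n x. T = grid m (steps T m) \<and> 0 < \<delta> \<and> \<delta> \<le> T - grid m k \<and> 0 < x
          \<and> m_zero \<mu> \<sigma> r \<le> real m \<and> 1 \<le> n
          \<and> 1 / K * (1 / real n + c1 / 2 ^ m) \<le> 1 / 2 \<longrightarrow>
        measure_pmf.prob (Q_law \<mu> \<sigma> r m x (steps T m - k)) {s. \<bar>s - K\<bar> \<le> 1 / real n}
          \<le> c5 / sqrt \<delta> * (1 / real n) + c6 / sqrt \<delta> / 2 ^ m)"

definition bs_stock :: "real \<Rightarrow> real \<Rightarrow> real \<Rightarrow> (real \<Rightarrow> real) \<Rightarrow> real \<Rightarrow> real" where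
  "bs_stock \<mu> \<sigma> s0 b t = s0 * exp ((\<mu> - \<sigma>\<^sup>2 / 2) * t + \<sigma> * b t)"

definition bs_price ::
  "'b measure \<Rightarrow> (real \<Rightarrow> 'b \<Rightarrow> real) \<Rightarrow> real \<Rightarrow> real \<Rightarrow> real \<Rightarrow> real \<Rightarrow> real \<Rightarrow> real \<Rightarrow> real" where
  "bs_price M W \<sigma> r T K t x = exp (- r * (T - t)) *
     (LINT \<omega>|M. put K (x * exp ((r - \<sigma>\<^sup>2 / 2) * (T - t) + \<sigma> * W (T - t) \<omega>)))"

text \<open>The price is differentiable in \<open>x\<close> at \<open>x > 0\<close> except for \<open>t = T\<close>, \<open>x = K\<close>, where
  it equals the payoff and the convention \<open>g'(K) = -1/2\<close> applies.\<close>

definition bs_delta ::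
  "'b measure \<Rightarrow> (real \<Rightarrow> 'b \<Rightarrow> real) \<Rightarrow> real \<Rightarrow> real \<Rightarrow> real \<Rightarrow> real \<Rightarrow> real \<Rightarrow> real \<Rightarrow> real" where
  "bs_delta M W \<sigma> r T K t x =
     (if t = T \<and> x = K then - 1 / 2 else deriv (bs_price M W \<sigma> r T K t) x)"

definition bs_a ::
  "'b measure \<Rightarrow> (real \<Rightarrow> 'b \<Rightarrow> real) \<Rightarrow> real \<Rightarrow> real \<Rightarrow> real \<Rightarrow> real \<Rightarrow> real \<Rightarrow> real
     \<Rightarrow> (real \<Rightarrow> real) \<Rightarrow> real \<Rightarrow> real" where
  "bs_a M W \<mu> \<sigma> r s0 T K b t = bs_delta M W \<sigma> r T K t (bs_stock \<mu> \<sigma> s0 b t)"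

definition bs_b ::
  "'b measure \<Rightarrow> (real \<Rightarrow> 'b \<Rightarrow> real) \<Rightarrow> real \<Rightarrow> real \<Rightarrow> real \<Rightarrow> real \<Rightarrow> real \<Rightarrow> real
     \<Rightarrow> (real \<Rightarrow> real) \<Rightarrow> real \<Rightarrow> real" where
  "bs_b M W \<mu> \<sigma> r s0 T K b t = exp (- r * t) *
     (bs_price M W \<sigma> r T K t (bs_stock \<mu> \<sigma> s0 b t)
        - bs_stock \<mu> \<sigma> s0 b t * bs_delta M W \<sigma> r T K t (bs_stock \<mu> \<sigma> s0 b t))"

end

theory Submission
  imports Defs "HOL-Real_Asymp.Real_Asymp"
begin

text \<open>(a) Mollification raises the put payoff by at most \<open>1/(2n)\<close>, and only within
  \<open>1/n\<close> of the strike. So \<open>P\<^sub>m\<close> and its smooth approximation differ by at most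
  \<open>1/(2n)\<close> times the probability of ending in that window, which \<open>c\<^sub>5, c\<^sub>6\<close> control;
  the difference quotient of the smooth price is compared with its derivative by \<open>c\<^sub>3\<close>, as
  \<open>g\<^sub>n'' \<le> n\<close>. The bound is needed at \<open>t\<^sub>k\<^sub>+\<^sub>1\<close> rather than \<open>t\<^sub>k\<close>: with two or
  more steps left this costs a factor that the estimate can spare, and with one step left
  the probability is bounded by 1 and \<open>c\<^sub>6 \<ge> 1/2\<close> is used instead.

  (b) The price and the hedge ratio are expectations of bounded functions of the logarithm of
  the product of price ratios. By Levy's theorem this logarithm converges in law to its
  Black--Scholes counterpart, and Skorohod's representation with dominated convergence passes
  to the limit, since difference quotients of the put payoff at \<open>x\<close> are bounded by about
  \<open>K/x\<close> and converge off the strike. The limit law charges no point as long as time remains;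
  at maturity, \<open>S(T) \<noteq> K\<close> almost surely takes its place.\<close>

section \<open>The mollified put payoff\<close>

text \<open>The choice of \<open>n\<close> balances two errors. With
  \<open>w = 2 powr (- m / 3)\<close> one has \<open>2^-m = w^3\<close> and \<open>1 / n\<close> of
  order \<open>w^2\<close>. The smooth price exceeds the put price by order \<open>1/n\<close> times
  \<open>1/n + 2^-m\<close>, that is \<open>w^4\<close>, and the difference quotient divides this by
  a spacing of order \<open>w^3\<close>; the comparison with the derivative costs
  \<open>n * 2^-m\<close>, again of order \<open>w\<close>. Without the window probability the first
  error would be of order \<open>w^2 / w^3\<close>, which diverges. The bounds of (a) blow up like
  \<open>1 / sqrt \<delta>\<close> near maturity, so they cannot give convergence uniformly up to
  \<open>T\<close>. Part (b) therefore works with the put price itself: discrete and limiting hedge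
  ratios are integrals of the same kind, and they converge jointly along arbitrary sequences of
  times and prices, maturity included. Randomness of the path enters only through three almost sure
  properties: the steps are signs, the approximations converge uniformly on bounded intervals to a
  continuous limit, and the final price misses the strike.\<close>

lemma isCont_exp_neg_inverse:
  "isCont (\<lambda>s::real. if 0 < s then exp (- 1 / s) else 0) s"
proof -
  let ?f = "\<lambda>s::real. if 0 < s then exp (- 1 / s) else 0"
  consider "s < 0" | "s > 0" | "s = 0" by linarith
  then show ?thesis
  proof cases
    case 1
    have ev: "eventually (\<lambda>y. y < 0) (nhds s)"
      using 1 by (rule order_tendstoD(2)[OF filterlim_ident])
    have "eventually (\<lambda>y. ?f y = 0) (nhds s)"
      by (rule eventually_mono[OF ev]) auto
    then show ?thesis by (subst isCont_cong) auto
  next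
    case 2
    have ev: "eventually (\<lambda>y. y > 0) (nhds s)"
      using 2 by (rule order_tendstoD(1)[OF filterlim_ident])
    have "eventually (\<lambda>y. ?f y = exp (- 1 / y)) (nhds s)"
      by (rule eventually_mono[OF ev]) auto
    moreover have "isCont (\<lambda>y. exp (- 1 / y)) s"
      using 2 by (intro continuous_intros) auto
    ultimately show ?thesis by (subst isCont_cong) auto
  next
    case 3
    have "\<bar>?f y\<bar> \<le> \<bar>y\<bar>" for y
    proof (cases "0 < y")
      case True
      have "1 / y \<le> exp (1 / y)" using exp_ge_add_one_self[of "1 / y"] by linarith
      then have "exp (- (1 / y)) \<le> y"
        using True by (simp add: exp_minus field_simps)
      then show ?thesis using True by simp
    qed auto
    then have "eventually (\<lambda>y. norm (?f y) \<le> \<bar>y\<bar>) (at 0)"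
      by (intro always_eventually allI) (simp only: real_norm_def)
    moreover have "((\<lambda>y::real. \<bar>y\<bar>) \<longlongrightarrow> 0) (at 0)"
      by (rule tendsto_rabs_zero[OF tendsto_ident_at])
    ultimately have "(?f \<longlongrightarrow> 0) (at 0)"
      by (rule Lim_null_comparison)
    then show ?thesis using 3 by (simp add: isCont_def)
  qed
qed

text \<open>Continuity is all the regularity of the bump that \<open>C2c\<close> asks for: the
  second derivative of the smoothed payoff is a rescaled mollifier, and no derivative falls on the
  bump.\<close>

lemma isCont_bump: "isCont bump u"
proof -
  have eq: "bump = (\<lambda>s::real. if 0 < s then exp (- 1 / s) else 0) \<circ> (\<lambda>u. 1 - u\<^sup>2)"
    by (auto simp: bump_def fun_eq_iff abs_square_less_1)
  show ?thesis
    unfolding eq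
    by (rule continuous_at_compose[OF _ isCont_exp_neg_inverse]) (intro continuous_intros)
qed

lemma bump_nonneg: "0 \<le> bump u"
  by (simp add: bump_def)

lemma bump_eq_0: "1 \<le> \<bar>u\<bar> \<Longrightarrow> bump u = 0"
  by (simp add: bump_def)

lemma bump_le: "bump u \<le> exp (- 1)"
proof (cases "\<bar>u\<bar> < 1")
  case True
  then have "u\<^sup>2 < 1" by (rule abs_square_less_1[THEN iffD2])
  then have "1 \<le> 1 / (1 - u\<^sup>2)" by (simp add: le_divide_eq_1)
  then show ?thesis using True by (simp add: bump_def)
qed (simp add: bump_def)

lemma bump_minus: "bump (- u) = bump u"
  by (simp add: bump_def)

lemma integrable_mult_bump:
  assumes "continuous_on UNIV f"
  shows "integrable lborel (\<lambda>u. f u * bump u)"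
proof -
  have "integrable lborel (\<lambda>u. indicator {-1..1} u *\<^sub>R (f u * bump u))"
    using assms isCont_bump
    by (intro borel_integrable_compact compact_Icc continuous_on_mult)
       (auto intro: continuous_on_subset continuous_at_imp_continuous_on)
  moreover have "(\<lambda>u. indicator {-1..1} u *\<^sub>R (f u * bump u)) = (\<lambda>u. f u * bump u)"
    by (auto simp: fun_eq_iff indicator_def intro!: bump_eq_0)
  ultimately show ?thesis by simp
qed

text \<open>A polynomial minorant that can be integrated exactly. With \<open>v = u^2\<close> and a
  factor \<open>exp (- 1)\<close> taken out, the exponent of the bump is
  \<open>1 - 1 / (1 - v)\<close>; then \<open>exp z \<ge> 1 + z\<close> and a polynomial comparison
  valid for \<open>v \<le> 1/2\<close> suffice. The number \<open>7/10\<close> is a rational just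
  below \<open>1 / sqrt 2\<close>.\<close>

lemma bump_lower:
  assumes "\<bar>u\<bar> \<le> 7/10"
  shows "exp (- 1) * (1 - u\<^sup>2 - 2 * u ^ 4) \<le> bump u"
proof -
  define v where "v = u\<^sup>2"
  have "\<bar>u\<bar> ^ 2 \<le> (7/10) ^ 2" using assms by (intro power_mono) auto
  then have "v \<le> (7/10) ^ 2" by (simp only: v_def power2_abs)
  also have "(7/10 :: real) ^ 2 \<le> 1/2" by (simp add: power_divide)
  finally have v: "0 \<le> v" "v \<le> 1/2" by (simp_all add: v_def)
  have "v * (v * (2 * v)) \<le> v * (v * 1)" using v by (intro mult_left_mono) auto
  then have "(1 - v - 2 * v\<^sup>2) * (1 - v) \<le> 1 - 2 * v"
    by (simp add: algebra_simps power2_eq_square)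
  then have "1 - v - 2 * v\<^sup>2 \<le> (1 - 2 * v) / (1 - v)"
    using v by (simp add: pos_le_divide_eq)
  also have "\<dots> = 1 + (1 - 1 / (1 - v))" using v by (simp add: field_simps)
  also have "\<dots> \<le> exp (1 - 1 / (1 - v))" by (rule exp_ge_add_one_self)
  also have "\<dots> = exp 1 * bump u"
    using assms by (simp add: bump_def v_def exp_add[symmetric])
  finally show ?thesis
    by (simp add: v_def exp_minus field_simps power_mult[symmetric])
qed

text \<open>The peak of the bump is \<open>exp (- 1)\<close>, so this is exactly what makes the
  mollifier at most 1, and hence the second derivative of the smoothed payoff at most
  \<open>n\<close>. The minorant integrates to about \<open>1.037 * exp (- 1)\<close>.\<close>

lemma integral_bump_ge: "exp (- 1) \<le> (LINT u|lborel. bump u)"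
proof -
  let ?p = "\<lambda>u::real. exp (- 1) * (1 - u\<^sup>2 - 2 * u ^ 4)"
  let ?F = "\<lambda>u::real. exp (- 1) * (u - u ^ 3 / 3 - 2 * u ^ 5 / 5)"
  have F: "has_bochner_integral lborel (\<lambda>u. ?p u * indicator {-7/10..7/10} u) (?F (7/10) - ?F (-7/10))"
  proof (rule has_bochner_integral_FTC_Icc_real)
    show "(?F has_real_derivative ?p u) (at u)" for u
      by (rule derivative_eq_intros refl | simp)+
    show "isCont ?p u" for u
      by (intro continuous_intros)
  qed simp
  have "1 \<le> ((7/10) - (7/10) ^ 3 / 3 - 2 * (7/10) ^ 5 / 5 :: real)
      - ((-7/10) - (-7/10) ^ 3 / 3 - 2 * (-7/10) ^ 5 / 5)"
    by (simp add: power_divide)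
  then have "exp (- 1) * 1 \<le> ?F (7/10) - ?F (-7/10)"
    unfolding right_diff_distrib[symmetric] by (rule mult_left_mono) simp
  then have "exp (- 1) \<le> ?F (7/10) - ?F (-7/10)" by simp
  also have "\<dots> = (LINT u|lborel. ?p u * indicator {-7/10..7/10} u)"
    using F by (simp add: has_bochner_integral_integral_eq)
  also have "\<dots> \<le> (LINT u|lborel. bump u)"
  proof (rule integral_mono)
    show "integrable lborel (\<lambda>u. ?p u * indicator {-7/10..7/10} u)"
      using F by (rule integrable.intros)
    show "integrable lborel bump" using integrable_mult_bump[of "\<lambda>_. 1"] by simp
    show "?p u * indicator {-7/10..7/10} u \<le> bump u" for u
      using bump_lower[of u] bump_nonneg[of u] by (auto simp: indicator_def abs_le_iff)
  qed
  finally show ?thesis .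
qed

lemma integral_bump_pos: "0 < (LINT u|lborel. bump u)"
  using integral_bump_ge exp_gt_zero[of "-1::real"] by linarith

lemma isCont_mollifier: "isCont mollifier u"
proof -
  have eq: "mollifier = (\<lambda>u. bump u / (LINT v|lborel. bump v))" by (auto simp: mollifier_def)
  show ?thesis unfolding eq using integral_bump_pos by (intro isCont_divide isCont_bump) auto
qed

lemma mollifier_nonneg: "0 \<le> mollifier u"
  using integral_bump_pos bump_nonneg by (simp add: mollifier_def)

lemma mollifier_le_1: "mollifier u \<le> 1"
  using integral_bump_pos bump_le[of u] integral_bump_ge by (simp add: mollifier_def)

lemma mollifier_eq_0: "1 \<le> \<bar>u\<bar> \<Longrightarrow> mollifier u = 0"
  by (simp add: mollifier_def bump_eq_0)

lemma mollifier_minus: "mollifier (- u) = mollifier u"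
  by (simp add: mollifier_def bump_minus)

lemma integrable_mult_mollifier:
  assumes "continuous_on UNIV f"
  shows "integrable lborel (\<lambda>u. f u * mollifier u)"
  using integrable_divide_zero[of "LINT v|lborel. bump v" lborel, OF integrable_mult_bump[OF assms]]
  by (simp add: mollifier_def)

lemma integral_mollifier: "(LINT u|lborel. mollifier u) = 1"
  using integral_bump_pos by (simp add: mollifier_def)

text \<open>All \<open>n\<close> and \<open>K\<close> reduce by scaling to this one function, the
  positive part mollified at unit scale. The plus sign in \<open>y + v\<close> comes from
  \<open>K - (s - u) = (K - s) + u\<close>.\<close>

definition smooth_ramp :: "real \<Rightarrow> real" where
  "smooth_ramp y = (LINT v|lborel. max (y + v) 0 * mollifier v)"


lemma smooth_put:
  assumes "1 \<le> n"
  shows "smooth n (put K) s = smooth_ramp (real n * (K - s)) / real n"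
proof -
  have n: "0 < real n" using assms by simp
  have eq: "put K (s - u) = max (real n * (K - s) + real n * u) 0 / real n" for u
  proof -
    have "real n * (K - s) + real n * u = real n * (K - (s - u))" by (simp add: algebra_simps)
    moreover have "max (real n * z) 0 / real n = max z 0" for z
      using n by (auto simp: max_def mult_le_0_iff)
    ultimately show ?thesis by (simp only: put_def)
  qed
  have "smooth_ramp (real n * (K - s)) =
      real n * (LINT u|lborel. max (real n * (K - s) + real n * u) 0 * mollifier (real n * u))"
    unfolding smooth_ramp_def using n by (subst lborel_integral_real_affine[of "real n" _ 0]) auto
  also have "(LINT u|lborel. max (real n * (K - s) + real n * u) 0 * mollifier (real n * u)) =
    smooth n (put K) s"
    using n unfolding smooth_def eq by simp
  finally show ?thesis using n by simp
qed

lemma isCont_antiderivative: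
  fixes f :: "real \<Rightarrow> real"
  assumes "\<And>x. isCont f x"
  shows "\<exists>F. \<forall>x. (F has_real_derivative f x) (at x)"
proof -
  obtain F where "\<forall>x::real. -\<infinity> < ereal x \<longrightarrow> ereal x < \<infinity> \<longrightarrow> (F has_vector_derivative f x) (at x)"
    using einterval_antiderivative[of "-\<infinity>" "\<infinity>" f, OF _ assms] by auto
  then have "(F has_real_derivative f x) (at x)" for x
    unfolding has_real_derivative_iff_has_vector_derivative by simp
  then show ?thesis by (intro exI[of _ F] allI)
qed

text \<open>Instead of differentiating under the integral, the ramp is expressed through
  antiderivatives \<open>Psi\<close> of the mollifier and \<open>Th\<close> of
  \<open>v * mollifier v\<close>. In the derivative of that expression the two terms containing the
  mollifier cancel.\<close>

lemma has_derivative_smooth_ramp: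
  "\<exists>G1. \<forall>y. (smooth_ramp has_real_derivative G1 y) (at y)
     \<and> (G1 has_real_derivative mollifier y) (at y)"
proof -
  have cont: "isCont mollifier v" "isCont (\<lambda>v. v * mollifier v) v" for v
    by (intro continuous_intros isCont_mollifier)+
  obtain Psi where Psi: "\<And>v. (Psi has_real_derivative mollifier v) (at v)"
    using isCont_antiderivative[OF cont(1)] by metis
  obtain Th where Th: "\<And>v. (Th has_real_derivative v * mollifier v) (at v)"
    using isCont_antiderivative[OF cont(2)] by metis
  have const: "H R = H 1"
    if H: "\<And>v. (H has_real_derivative h v) (at v)" and h: "\<And>v. 1 \<le> \<bar>v\<bar> \<Longrightarrow> h v = 0"
     and "1 \<le> R" for H h :: "real \<Rightarrow> real" and R
  proof (cases "R = 1")
    case False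
    show "H R = H 1"
    proof (rule DERIV_isconst2[of 1 R H R])
      show "1 < R" using False \<open>1 \<le> R\<close> by simp
      show "continuous_on {1..R} H"
        by (intro continuous_at_imp_continuous_on ballI DERIV_isCont[OF H])
      show "(H has_real_derivative 0) (at x)" if "1 < x" "x < R" for x
        using H[of x] h[of x] \<open>1 < x\<close> by simp
      show "1 \<le> R" "R \<le> R" using \<open>1 \<le> R\<close> by auto
    qed
  qed simp
  have ramp: "smooth_ramp y = y * (Psi 1 - Psi (- y)) + (Th 1 - Th (- y))" for y
  proof -
    \<comment> \<open>\<open>R\<close> is at least \<open>- y\<close> and at least 1, the right end
      of the support, beyond which the antiderivatives are constant.\<close>
    define R where "R = \<bar>y\<bar> + 1"
    have "smooth_ramp y = (LINT v|lborel. ((y + v) * mollifier v) * indicator {-y..R} v)"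
      unfolding smooth_ramp_def
      by (rule Bochner_Integration.integral_cong)
         (auto simp: R_def indicator_def mollifier_eq_0)
    also have "\<dots> = (y * Psi R + Th R) - (y * Psi (-y) + Th (-y))"
    proof (rule integral_FTC_Icc_real)
      show "-y \<le> R" by (simp add: R_def)
      show "((\<lambda>v. y * Psi v + Th v) has_real_derivative (y + v) * mollifier v) (at v)" for v
        by (auto intro!: derivative_eq_intros Psi Th simp: algebra_simps)
      show "isCont (\<lambda>v. (y + v) * mollifier v) v" for v
        by (intro continuous_intros isCont_mollifier)
    qed
    also have "Psi R = Psi 1" by (rule const[OF Psi]) (auto simp: mollifier_eq_0 R_def)
    also have "Th R = Th 1" by (rule const[OF Th]) (auto simp: mollifier_eq_0 R_def)
    finally show ?thesis by (simp add: algebra_simps)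
  qed
  have minus: "((\<lambda>y. H (- y)) has_real_derivative - h (- y)) (at y)"
    if "\<And>v. (H has_real_derivative h v) (at v)" for H h :: "real \<Rightarrow> real" and y
  proof -
    have "(uminus has_real_derivative - 1) (at y)"
      using DERIV_minus[OF DERIV_ident, of y UNIV] by simp
    from DERIV_chain2[where f = H and g = uminus, OF that this] show ?thesis by simp
  qed
  show ?thesis
  proof (intro exI[of _ "\<lambda>y. Psi 1 - Psi (- y)"] allI conjI)
    fix y
    have "((\<lambda>y. y * (Psi 1 - Psi (- y)) + (Th 1 - Th (- y))) has_real_derivative
        (Psi 1 - Psi (-y))) (at y)"
      by (rule derivative_eq_intros minus[OF Psi] minus[OF Th] refl | simp)+
    then show "(smooth_ramp has_real_derivative (Psi 1 - Psi (-y))) (at y)"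
      using ramp by presburger
    show "((\<lambda>y. Psi 1 - Psi (- y)) has_real_derivative mollifier y) (at y)"
      using DERIV_diff[OF DERIV_const minus[OF Psi], of "Psi 1" y] by (simp add: mollifier_minus)
  qed
qed

text \<open>The mollifier is even, so the integrand may be averaged over \<open>v\<close> and
  \<open>- v\<close>. The resulting excess is visibly nonnegative, at most 1/2, and zero for
  \<open>\<bar>y\<bar> \<ge> 1\<close>; its 1/2 becomes the \<open>1 / (2 * n)\<close> of the
  payoff.\<close>

lemma smooth_ramp_minus_max:
  "smooth_ramp y - max y 0 = (LINT v|lborel. max (\<bar>v\<bar> - \<bar>y\<bar>) 0 * mollifier v) / 2"
proof -
  have int: "integrable lborel (\<lambda>v. f v * mollifier v)" if "continuous_on UNIV f" for f
    by (rule integrable_mult_mollifier[OF that])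
  have "smooth_ramp y = (LINT v|lborel. max (y - v) 0 * mollifier v)"
    unfolding smooth_ramp_def
    by (subst lborel_integral_real_affine[of "-1" _ 0]) (auto simp: mollifier_minus)
  then have "2 * smooth_ramp y =
      (LINT v|lborel. max (y + v) 0 * mollifier v) + (LINT v|lborel. max (y - v) 0 * mollifier v)"
    by (simp add: smooth_ramp_def)
  also have "\<dots> = (LINT v|lborel. max (y + v) 0 * mollifier v + max (y - v) 0 * mollifier v)"
    by (intro Bochner_Integration.integral_add[symmetric] int continuous_intros)
  also have "\<dots> = (LINT v|lborel. 2 * max y 0 * mollifier v + max (\<bar>v\<bar> - \<bar>y\<bar>) 0 * mollifier v)"
  proof (rule Bochner_Integration.integral_cong[OF refl])
    fix v
    have "max (y + v) 0 + max (y - v) 0 = 2 * max y 0 + max (\<bar>v\<bar> - \<bar>y\<bar>) 0" by linarith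
    from arg_cong[OF this, of "\<lambda>z. z * mollifier v"]
    show "max (y + v) 0 * mollifier v + max (y - v) 0 * mollifier v =
      2 * max y 0 * mollifier v + max (\<bar>v\<bar> - \<bar>y\<bar>) 0 * mollifier v" by (simp only: distrib_right)
  qed
  also have "\<dots> = (LINT v|lborel. 2 * max y 0 * mollifier v) +
     (LINT v|lborel. max (\<bar>v\<bar> - \<bar>y\<bar>) 0 * mollifier v)"
    by (intro Bochner_Integration.integral_add int continuous_intros)
  also have "(LINT v|lborel. 2 * max y 0 * mollifier v) = 2 * max y 0"
    by (simp add: integral_mollifier)
  finally show ?thesis by simp
qed

lemma smooth_ramp_bounds:
  shows "max y 0 \<le> smooth_ramp y" "smooth_ramp y \<le> max y 0 + 1 / 2"
    and "1 \<le> \<bar>y\<bar> \<Longrightarrow> smooth_ramp y = max y 0"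
proof -
  let ?h = "\<lambda>v. max (\<bar>v\<bar> - \<bar>y\<bar>) 0 * mollifier v"
  have "0 \<le> (LINT v|lborel. ?h v)"
    by (intro integral_nonneg_AE) (auto simp: mollifier_nonneg)
  then show "max y 0 \<le> smooth_ramp y" using smooth_ramp_minus_max[of y] by argo
  have "(LINT v|lborel. ?h v) \<le> (LINT v|lborel. mollifier v)"
  proof (rule integral_mono)
    show "integrable lborel ?h" by (intro integrable_mult_mollifier continuous_intros)
    show "integrable lborel mollifier" using integrable_mult_mollifier[of "\<lambda>_. 1"] by simp
    show "?h v \<le> mollifier v" for v
      using mollifier_nonneg[of v]
      by (cases "\<bar>v\<bar> < 1") (auto simp: mollifier_eq_0 intro!: mult_left_le_one_le)
  qed
  then show "smooth_ramp y \<le> max y 0 + 1 / 2"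
    using smooth_ramp_minus_max[of y] integral_mollifier by simp
  assume "1 \<le> \<bar>y\<bar>"
  then have "?h v = 0" for v by (cases "\<bar>v\<bar> < 1") (auto simp: mollifier_eq_0)
  then have "(LINT v|lborel. ?h v) = 0" by (simp only: integral_zero)
  then show "smooth_ramp y = max y 0" using smooth_ramp_minus_max[of y] by linarith
qed

lemma smooth_put_bounds:
  assumes "1 \<le> n"
  shows "put K s \<le> smooth n (put K) s"
    and "smooth n (put K) s \<le> put K s + 1 / (2 * real n) * indicator {s. \<bar>s - K\<bar> \<le> 1 / real n} s"
proof -
  have n: "0 < real n" using assms by simp
  have put: "put K s = max (real n * (K - s)) 0 / real n"
    using n by (auto simp: put_def max_def field_simps)
  show "put K s \<le> smooth n (put K) s"
    unfolding smooth_put[OF assms] put using n smooth_ramp_bounds(1) by (intro divide_right_mono) auto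
  show "smooth n (put K) s \<le> put K s + 1 / (2 * real n) * indicator {s. \<bar>s - K\<bar> \<le> 1 / real n} s"
  proof (cases "\<bar>s - K\<bar> \<le> 1 / real n")
    case True
    then show ?thesis
      unfolding smooth_put[OF assms] put using n smooth_ramp_bounds(2)[of "real n * (K - s)"]
      by (simp add: field_simps)
  next
    case False
    then have "1 \<le> \<bar>real n * (K - s)\<bar>" using n by (simp add: abs_mult abs_minus_commute[of K] not_le divide_less_eq mult.commute)
    then show ?thesis
      unfolding smooth_put[OF assms] put using smooth_ramp_bounds(3) False by simp
  qed
qed

lemma C2c_smooth_put:
  assumes "1 \<le> n"
  shows "C2c (smooth n (put K)) (\<lambda>s. real n * mollifier (real n * (K - s)))"
proof -
  have n: "0 < real n" using assms by simp
  obtain G1 where G: "\<And>y. (smooth_ramp has_real_derivative G1 y) (at y)"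
    "\<And>y. (G1 has_real_derivative mollifier y) (at y)"
    using has_derivative_smooth_ramp by metis
  have eq: "smooth n (put K) = (\<lambda>s. smooth_ramp (real n * (K - s)) / real n)"
    by (rule ext) (rule smooth_put[OF assms])
  have inner: "((\<lambda>s. real n * (K - s)) has_real_derivative - real n) (at s)" for s
    by (auto intro!: derivative_eq_intros)
  have d1: "(smooth n (put K) has_real_derivative - G1 (real n * (K - s))) (at s)" for s
    unfolding eq using DERIV_cdivide[OF DERIV_chain2[OF G(1) inner], of "real n"] n by simp
  have d2: "((\<lambda>s. - G1 (real n * (K - s))) has_real_derivative real n * mollifier (real n * (K - s))) (at s)" for s
    using DERIV_minus[OF DERIV_chain2[OF G(2) inner]] by (simp add: mult.commute)
  have "smooth n (put K) s = 0" if "K + 1 / real n \<le> s" for s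
  proof -
    have "real n * (K - s) \<le> - 1" using that n by (simp add: field_simps)
    then show ?thesis using smooth_ramp_bounds(3)[of "real n * (K - s)"] by (simp add: eq)
  qed
  moreover have "continuous_on {0..} (\<lambda>s. real n * mollifier (real n * (K - s)))"
    by (intro continuous_at_imp_continuous_on ballI continuous_intros
        isCont_o2[OF _ isCont_mollifier])
  ultimately show ?thesis
    unfolding C2c_def
    by (intro conjI exI[of _ "\<lambda>s. - G1 (real n * (K - s))"] exI[of _ "K + 1 / real n"] allI impI
       has_field_derivative_at_within[OF d1] has_field_derivative_at_within[OF d2])
qed

lemma SUP_second_derivative_smooth_put:
  "(SUP s\<in>{0..}. \<bar>real n * mollifier (real n * (K - s))\<bar>) \<le> real n"
  by (rule cSUP_least) (auto simp: abs_mult mollifier_nonneg intro!: mult_left_le mollifier_le_1)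

section \<open>Error of the approximate portfolio\<close>

lemma drift_ratio_le:
  assumes "m_zero \<mu> \<sigma> r \<le> real m" "0 < \<sigma>"
  shows "\<bar>(r - \<mu>) / \<sigma>\<bar> \<le> 2 ^ m"
proof (cases "r = \<mu>")
  case False
  then have pos: "0 < \<bar>r - \<mu>\<bar> / \<sigma>" using assms by simp
  have "ln (\<bar>r - \<mu>\<bar> / \<sigma>) \<le> real m * ln 2"
    using assms(1) by (simp add: m_zero_def field_simps)
  also have "\<dots> = ln (2 ^ m)" by (simp add: ln_realpow)
  finally have "\<bar>r - \<mu>\<bar> / \<sigma> \<le> 2 ^ m" using pos by simp
  then show ?thesis using assms(2) by simp
qed simp

lemma q_up_bounds:
  assumes "m_zero \<mu> \<sigma> r \<le> real m" "0 < \<sigma>"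
  shows "q_up \<mu> \<sigma> r m \<in> {0..1}"
proof -
  have "\<bar>(r - \<mu>) / \<sigma> / 2 ^ m\<bar> \<le> 1"
    using drift_ratio_le[OF assms]
    by (subst abs_divide) (simp add: divide_le_eq_1_pos del: abs_divide)
  then show ?thesis unfolding q_up_def atLeastAtMost_iff by linarith
qed

lemma q_down_eq: "q_down \<mu> \<sigma> r m = 1 - q_up \<mu> \<sigma> r m"
  by (simp add: q_up_def q_down_def)

lemma F_disc_expectation:
  assumes "q_up \<mu> \<sigma> r m \<in> {0..1}" and "j = steps T m - k"
  shows "F_disc \<mu> \<sigma> r T m h k x =
    measure_pmf.expectation (binomial_pmf j (q_up \<mu> \<sigma> r m))
      (\<lambda>i. h (x * (up \<mu> \<sigma> m ^ i * down \<mu> \<sigma> m ^ (j - i)))) / rate r m ^ j"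
  unfolding expectation_binomial_pmf'[OF assms(1)] F_disc_def Let_def assms(2) q_down_eq
  by (simp add: atMost_atLeast0 mult.assoc)

text \<open>The product depends on the coin tosses only through the number of successes. This makes
  the bound on \<open>Q_law\<close> applicable to the binomial sums in
  \<open>F_disc\<close>.\<close>

lemma Q_law_binomial:
  assumes "q_up \<mu> \<sigma> r m \<in> {0..1}"
  shows "Q_law \<mu> \<sigma> r m x j =
    map_pmf (\<lambda>i. x * (up \<mu> \<sigma> m ^ i * down \<mu> \<sigma> m ^ (j - i))) (binomial_pmf j (q_up \<mu> \<sigma> r m))"
proof -
  have "(\<Prod>i<j. if \<epsilon> i then up \<mu> \<sigma> m else down \<mu> \<sigma> m) =
      up \<mu> \<sigma> m ^ card {i\<in>{..<j}. \<epsilon> i} * down \<mu> \<sigma> m ^ (j - card {i\<in>{..<j}. \<epsilon> i})" for \<epsilon>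
  proof -
    have eq: "{..<j} \<inter> {i. \<epsilon> i} = {i\<in>{..<j}. \<epsilon> i}" "{..<j} \<inter> - {i. \<epsilon> i} = {..<j} - {i\<in>{..<j}. \<epsilon> i}" by auto
    have "card ({..<j} - {i\<in>{..<j}. \<epsilon> i}) = j - card {i\<in>{..<j}. \<epsilon> i}"
      by (subst card_Diff_subset) auto
    then show ?thesis by (simp add: prod.If_cases eq)
  qed
  then show ?thesis
    unfolding Q_law_def
    by (subst binomial_pmf_altdef'[of "{..<j}" j _ False])
       (use assms in \<open>auto simp: map_pmf_comp\<close>)
qed

lemma rate_ge_1: "0 \<le> r \<Longrightarrow> 1 \<le> rate r m"
  by (simp add: rate_def)

lemma P_smooth_minus_P_disc:
  assumes q: "q_up \<mu> \<sigma> r m \<in> {0..1}" and "0 \<le> r" "1 \<le> n"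
  shows "0 \<le> P_smooth \<mu> \<sigma> r T K m n k y - P_disc \<mu> \<sigma> r T K m k y"
    and "P_smooth \<mu> \<sigma> r T K m n k y - P_disc \<mu> \<sigma> r T K m k y \<le>
      measure_pmf.prob (Q_law \<mu> \<sigma> r m y (steps T m - k)) {s. \<bar>s - K\<bar> \<le> 1 / real n} / (2 * real n)"
proof -
  define j where "j = steps T m - k"
  define S where "S = (\<lambda>i. y * (up \<mu> \<sigma> m ^ i * down \<mu> \<sigma> m ^ (j - i)))"
  define p where "p = binomial_pmf j (q_up \<mu> \<sigma> r m)"
  let ?E = "measure_pmf.expectation p"
  let ?A = "{s. \<bar>s - K\<bar> \<le> 1 / real n}"
  have int: "integrable (measure_pmf p) f" for f :: "nat \<Rightarrow> real"
    unfolding p_def using q by (rule integrable_binomial_pmf)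
  have eq: "P_smooth \<mu> \<sigma> r T K m n k y - P_disc \<mu> \<sigma> r T K m k y =
    ?E (\<lambda>i. smooth n (put K) (S i) - put K (S i)) / rate r m ^ j"
    unfolding P_smooth_def P_disc_def F_disc_expectation[OF q j_def] p_def[symmetric]
    by (simp add: S_def Bochner_Integration.integral_diff[OF int int] diff_divide_distrib)
  have rate: "1 \<le> rate r m ^ j" using rate_ge_1[OF \<open>0 \<le> r\<close>] by (rule one_le_power)
  have nonneg: "0 \<le> ?E (\<lambda>i. smooth n (put K) (S i) - put K (S i))"
    using smooth_put_bounds(1)[OF \<open>1 \<le> n\<close>] by (intro integral_nonneg_AE) auto
  then show "0 \<le> P_smooth \<mu> \<sigma> r T K m n k y - P_disc \<mu> \<sigma> r T K m k y"
    unfolding eq using rate by (intro divide_nonneg_pos) auto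
  have "P_smooth \<mu> \<sigma> r T K m n k y - P_disc \<mu> \<sigma> r T K m k y
      \<le> ?E (\<lambda>i. smooth n (put K) (S i) - put K (S i))"
    unfolding eq using divide_left_mono[OF rate nonneg] rate by simp
  also have "\<dots> \<le> ?E (\<lambda>i. 1 / (2 * real n) * indicator ?A (S i))"
  proof (rule integral_mono[OF int int])
    show "smooth n (put K) (S i) - put K (S i) \<le> 1 / (2 * real n) * indicator ?A (S i)" for i
      using smooth_put_bounds(2)[OF \<open>1 \<le> n\<close>, of K "S i"] by linarith
  qed
  also have "\<dots> = 1 / (2 * real n) * ?E (\<lambda>i. indicator ?A (S i))"
    by (rule integral_mult_right_zero)
  also have "?E (\<lambda>i. indicator ?A (S i)) = measure_pmf.prob p (S -` ?A)"
  proof -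
    have "(\<lambda>i. indicator ?A (S i) :: real) = indicator (S -` ?A)"
      by (auto simp: indicator_def)
    then show ?thesis by simp
  qed
  also have "\<dots> = measure_pmf.prob (Q_law \<mu> \<sigma> r m y j) ?A"
    unfolding Q_law_binomial[OF q] measure_map_pmf S_def p_def ..
  finally show "P_smooth \<mu> \<sigma> r T K m n k y - P_disc \<mu> \<sigma> r T K m k y \<le>
      measure_pmf.prob (Q_law \<mu> \<sigma> r m y (steps T m - k)) ?A / (2 * real n)"
    by (simp add: j_def)
qed


text \<open>A maturity on the grid lies on every finer grid, so the bound with \<open>c5\<close> and
  \<open>c6\<close> can be tested at finer levels.\<close>

lemma steps_grid_refine:
  assumes "T = grid m (steps T m)" "m \<le> m'"
  shows "T = grid m' (steps T m')"
proof -
  have "T * 2 ^ (2 * m') = real (steps T m) * (2 ^ (2 * m') / 2 ^ (2 * m))"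
    by (subst assms(1)) (simp add: grid_def)
  also have "(2::real) ^ (2 * m') / 2 ^ (2 * m) = 2 ^ (2 * m' - 2 * m)"
    using assms(2) by (simp add: power_diff)
  also have "real (steps T m) * 2 ^ (2 * m' - 2 * m) = real (steps T m * 2 ^ (2 * m' - 2 * m))"
    by simp
  finally have eq: "T * 2 ^ (2 * m') = real (steps T m * 2 ^ (2 * m' - 2 * m))" .
  then have "steps T m' = steps T m * 2 ^ (2 * m' - 2 * m)"
    unfolding steps_def[of T m'] eq by (metis floor_of_nat nat_int)
  then have "grid m' (steps T m') = T * 2 ^ (2 * m') / 2 ^ (2 * m')"
    unfolding eq grid_def by simp
  then show ?thesis by simp
qed

lemma power_double_eq_square: "(2::real) ^ (2 * m) = (2 ^ m)\<^sup>2"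
  by (simp add: power_mult[symmetric] mult.commute)

lemma LIMSEQ_up: "(\<lambda>m. up \<mu> \<sigma> m) \<longlonglongrightarrow> 1"
  and LIMSEQ_down: "(\<lambda>m. down \<mu> \<sigma> m) \<longlonglongrightarrow> 1"
  unfolding up_def down_def by real_asymp+

lemma up_minus_down: "up \<mu> \<sigma> m - down \<mu> \<sigma> m = 2 * \<sigma> / 2 ^ m"
  by (simp add: up_def down_def)

text \<open>For a single step, a start at \<open>K / u\<close> or \<open>K / d\<close> makes the price hit \<open>K\<close> with
  probability at least 1/2, however small the window around \<open>K\<close>.\<close>

lemma c6_ge_half:
  assumes c: "is_c5_c6 \<mu> \<sigma> r T K c1 c5 c6"
    and T: "T = grid m (steps T m)" "0 < T" and m: "m_zero \<mu> \<sigma> r \<le> real m"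
    and n: "1 \<le> n" "1 / K * (1 / real n + c1 / 2 ^ m) \<le> 1 / 2" and pos: "0 < c1" "0 < \<sigma>" "0 < K"
  shows "1 / 2 \<le> c6"
proof (rule ccontr)
  assume c6: "\<not> 1 / 2 \<le> c6"
  \<comment> \<open>\<open>K / down\<close> will serve as a starting price, so a level with positive
    \<open>down\<close> is chosen; going finer preserves the window condition and the grid
    condition.\<close>
  have "eventually (\<lambda>m'. 0 < down \<mu> \<sigma> m' \<and> m \<le> m') sequentially"
    using order_tendstoD(1)[OF LIMSEQ_down, of 0 \<mu> \<sigma>] eventually_ge_at_top[of m]
    by (simp add: eventually_conj_iff)
  then obtain m' where m': "0 < down \<mu> \<sigma> m'" "m \<le> m'"
    using eventually_happens' sequentially_bot by blast
  have up: "0 < up \<mu> \<sigma> m'"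

  proof -
    have "0 < 2 * \<sigma> / 2 ^ m'" using pos(2) by simp
    then show ?thesis using m'(1) up_minus_down[of \<mu> \<sigma> m'] by linarith
  qed
  have T': "T = grid m' (steps T m')" by (rule steps_grid_refine[OF T(1) m'(2)])
  define k where "k = steps T m' - 1"
  have "0 < steps T m'" using T' T(2) by (cases "steps T m'") (auto simp: grid_def)
  then have k: "Suc k = steps T m'" by (simp add: k_def)
  have "T = grid m' (Suc k)" using T' k by simp
  then have delta: "1 / 2 ^ (2 * m') = T - grid m' k"
    by (simp add: grid_def diff_divide_distrib[symmetric])
  define q where "q = q_up \<mu> \<sigma> r m'"
  have m0: "m_zero \<mu> \<sigma> r \<le> real m'" using m m'(2) by linarith
  have q: "q \<in> {0..1}" unfolding q_def by (rule q_up_bounds[OF m0 pos(2)])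
  obtain x i where x: "0 < x" and hit: "x * (up \<mu> \<sigma> m' ^ i * down \<mu> \<sigma> m' ^ (1 - i)) = K"
    and i: "1 / 2 \<le> pmf (binomial_pmf 1 q) i"
  proof (cases "1 / 2 \<le> q")
    case True
    show ?thesis using True q up pos by (intro that[of "K / up \<mu> \<sigma> m'" 1]) auto
  next
    case False
    then show ?thesis using q m' pos by (intro that[of "K / down \<mu> \<sigma> m'" 0]) auto
  qed
  \<comment> \<open>One step before maturity the remaining time has square root
    \<open>2^-m'\<close>, which cancels the \<open>2^-m'\<close> of the \<open>c6\<close> term. Only
    the \<open>c5\<close> term depends on \<open>n'\<close>, and it vanishes as \<open>n'\<close>
    grows.\<close>
  have le: "1 / 2 \<le> c5 * 2 ^ m' / real n' + c6" if "n \<le> n'" for n'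
  proof -
    have n': "0 < real n'" "1 \<le> n'" using n(1) that by auto
    have "1 / real n' + c1 / 2 ^ m' \<le> 1 / real n + c1 / 2 ^ m"
      using that n(1) pos m'(2) by (intro add_mono divide_left_mono) auto
    then have "1 / K * (1 / real n' + c1 / 2 ^ m') \<le> 1 / K * (1 / real n + c1 / 2 ^ m)"
      using pos by (intro mult_left_mono) auto
    then have "1 / K * (1 / real n' + c1 / 2 ^ m') \<le> 1 / 2" using n(2) by linarith
    then have "measure_pmf.prob (Q_law \<mu> \<sigma> r m' x (steps T m' - k)) {s. \<bar>s - K\<bar> \<le> 1 / real n'}
       \<le> c5 / sqrt (1 / 2 ^ (2 * m')) * (1 / real n') + c6 / sqrt (1 / 2 ^ (2 * m')) / 2 ^ m'"
      using c T' delta x m0 n'(2) unfolding is_c5_c6_def by (metis order_refl zero_less_divide_1_iff zero_less_numeral zero_less_power)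
    also have "sqrt (1 / 2 ^ (2 * m')) = 1 / 2 ^ m'"
      unfolding power_double_eq_square by (simp add: real_sqrt_divide)
    also have "c5 / (1 / 2 ^ m') * (1 / real n') + c6 / (1 / 2 ^ m') / 2 ^ m' = c5 * 2 ^ m' / real n' + c6"
      by simp
    finally have bd: "measure_pmf.prob (Q_law \<mu> \<sigma> r m' x (steps T m' - k)) {s. \<bar>s - K\<bar> \<le> 1 / real n'}
       \<le> c5 * 2 ^ m' / real n' + c6" .
    have "1 / 2 \<le> measure_pmf.prob (binomial_pmf 1 q) {i}" using i by (simp add: measure_pmf_single)
    also have "\<dots> \<le> measure_pmf.prob (binomial_pmf 1 q)
        ((\<lambda>i. x * (up \<mu> \<sigma> m' ^ i * down \<mu> \<sigma> m' ^ (1 - i))) -` {s. \<bar>s - K\<bar> \<le> 1 / real n'})"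
      using hit by (intro measure_pmf.finite_measure_mono) auto
    also have "\<dots> = measure_pmf.prob (Q_law \<mu> \<sigma> r m' x (steps T m' - k)) {s. \<bar>s - K\<bar> \<le> 1 / real n'}"
      using Q_law_binomial[OF q[unfolded q_def], of x 1] k by (simp add: q_def flip: k)
    finally show ?thesis using bd by linarith
  qed
  obtain n' where "c5 * 2 ^ m' / (1 / 2 - c6) < real n'" using reals_Archimedean2 by blast
  then have "c5 * 2 ^ m' / (1 / 2 - c6) < real (max n n')" by simp
  then have "c5 * 2 ^ m' < real (max n n') * (1 / 2 - c6)"
    using c6 by (simp only: pos_divide_less_eq not_le diff_gt_0_iff_gt)
  moreover have "0 < real (max n n')" using n(1) by simp
  ultimately have "c5 * 2 ^ m' / real (max n n') < 1 / 2 - c6"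
    by (simp only: pos_divide_less_eq mult.commute)
  moreover have "1 / 2 \<le> c5 * 2 ^ m' / real (max n n') + c6" by (rule le) simp
  ultimately show False by linarith
qed

section \<open>The bounds of (a) at a fixed grid point\<close>

context
  fixes \<mu> \<sigma> r T K c1 c5 c6 \<delta> x :: real and m n k :: nat
  assumes pos: "0 < \<sigma>" "0 < r" "0 < T" "0 < K" "0 < c1" "0 < x"
    and c56: "is_c5_c6 \<mu> \<sigma> r T K c1 c5 c6"
    and delta: "0 < \<delta>" "\<delta> \<le> T - grid m k"
    and m: "m_zero \<mu> \<sigma> r \<le> real m" "0 \<le> down \<mu> \<sigma> m"
    and T: "T = grid m (steps T m)"
    and n: "n = nat \<lceil>2 powr (2 * real m / 3)\<rceil>"
    and window: "1 / K * (1 / real n + c1 / 2 ^ m) \<le> 1 / 2"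
begin

text \<open>All scales are controlled by integer powers of this unit: \<open>2^-m\<close> is its
  cube, the time step its sixth power, and \<open>1 / n\<close> at most its square. The estimates
  below then amount to counting powers.\<close>

private definition "w = 2 powr (- real m / 3)"

private lemma w: "0 < w" "w \<le> 1" "1 / 2 ^ m = w ^ 3" "2 ^ m = 1 / w ^ 3" "1 / 2 ^ (2 * m) = w ^ 6"
proof -
  show "0 < w" by (simp add: w_def)
  have "2 powr (- real m / 3) \<le> 2 powr (0::real)" by (rule powr_mono) auto
  then show "w \<le> 1" by (simp add: w_def)
  have "w ^ 3 = 2 powr (- real m)" by (simp add: w_def powr_power)
  then show "1 / 2 ^ m = w ^ 3" "2 ^ m = 1 / w ^ 3"
    using \<open>0 < w\<close> by (simp_all add: powr_minus powr_realpow divide_simps mult.commute)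
  then show "1 / 2 ^ (2 * m) = w ^ 6"
    by (simp add: power_double_eq_square power_divide power_mult[symmetric])
qed

text \<open>Rounding up adds at most 1, and \<open>1 \<le> 1 / w^2\<close>. The resulting factor 2
  is the one in \<open>2 * c3 * x\<close>.\<close>

private lemma n_bounds: "1 \<le> n" "1 / real n \<le> w\<^sup>2" "real n \<le> 2 / w\<^sup>2"
proof -
  have v: "2 powr (2 * real m / 3) = 1 / w\<^sup>2"
    by (simp add: w_def powr_power powr_minus divide_simps flip: powr_add)
  have v1: "1 \<le> 1 / w\<^sup>2" using w power_le_one[of w 2] by (simp add: field_simps)
  have nn: "1 / w\<^sup>2 \<le> real n" "real n \<le> 1 / w\<^sup>2 + 1"
    unfolding n v using v1 by linarith+
  show "1 \<le> n" using nn v1 by linarith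
  show "1 / real n \<le> w\<^sup>2" using nn(1) \<open>1 \<le> n\<close> w by (simp add: field_simps)
  show "real n \<le> 2 / w\<^sup>2" using nn v1 by (simp add: add_divide_distrib[symmetric])
qed

text \<open>For the degenerate start \<open>y = 0\<close>, which arises when \<open>down\<close>
  vanishes: the price stays at 0, which must lie outside the window around \<open>K\<close>.\<close>

private lemma inverse_n_less_K: "1 / real n < K"
proof -
  have "1 / real n + c1 / 2 ^ m \<le> K / 2" using window pos by (simp add: field_simps)
  moreover have "0 < c1 / 2 ^ m" using pos by simp
  ultimately show ?thesis using pos by linarith
qed

private lemma k_less: "k < steps T m"
proof -
  have "grid m k < grid m (steps T m)" using delta T by linarith
  then show ?thesis by (simp add: grid_def divide_less_cancel)
qed

private lemma smooth_error:
  assumes y: "0 \<le> y"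
  shows "0 \<le> P_smooth \<mu> \<sigma> r T K m n (Suc k) y - P_disc \<mu> \<sigma> r T K m (Suc k) y"
    and "P_smooth \<mu> \<sigma> r T K m n (Suc k) y - P_disc \<mu> \<sigma> r T K m (Suc k) y
      \<le> (c5 + c6) / sqrt \<delta> * w ^ 4"
proof -
  have q: "q_up \<mu> \<sigma> r m \<in> {0..1}" by (rule q_up_bounds[OF m(1) pos(1)])
  have r: "0 \<le> r" using pos by simp
  show "0 \<le> P_smooth \<mu> \<sigma> r T K m n (Suc k) y - P_disc \<mu> \<sigma> r T K m (Suc k) y"
    by (rule P_smooth_minus_P_disc(1)[OF q r n_bounds(1)])
  define p where "p = measure_pmf.prob (Q_law \<mu> \<sigma> r m y (steps T m - Suc k)) {s. \<bar>s - K\<bar> \<le> 1 / real n}"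
  have c: "0 < c5" "0 < c6" using c56 by (auto simp: is_c5_c6_def)
  have sq: "0 < sqrt \<delta>" using delta by simp
  have p0: "0 \<le> p" by (simp add: p_def)
  have "P_smooth \<mu> \<sigma> r T K m n (Suc k) y - P_disc \<mu> \<sigma> r T K m (Suc k) y \<le> p / (2 * real n)"
    unfolding p_def by (rule P_smooth_minus_P_disc(2)[OF q r n_bounds(1)])
  also have "\<dots> = p / 2 * (1 / real n)" by simp
  also have "\<dots> \<le> p / 2 * w\<^sup>2" using n_bounds(2) p0 by (intro mult_left_mono) auto
  also have "p / 2 \<le> (c5 + c6) / sqrt \<delta> * w\<^sup>2"
  proof -
    \<comment> \<open>The bound with \<open>c5\<close> and \<open>c6\<close> covers neither a start
      at 0 nor zero remaining time, so these two cases are separate.\<close>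
    consider "y = 0" | "0 < y" "Suc k = steps T m" | "0 < y" "Suc k < steps T m"
      using y k_less by linarith
    then show ?thesis
    proof cases
      case 1
      have "p = 0"
        using inverse_n_less_K pos unfolding p_def Q_law_binomial[OF q] measure_map_pmf 1
        by (simp add: measure_pmf.emeasure_eq_measure vimage_def)
      then show ?thesis using c sq w by simp
    next
      case 2
      \<comment> \<open>Here \<open>\<delta>\<close> is at most one time step, so
        \<open>sqrt \<delta> \<le> w^3 \<le> w^2\<close>. The claimed bound is then at least
        \<open>c5 + c6\<close>, hence at least 1/2, and \<open>p / 2\<close> cannot exceed
        that.\<close>
      have "\<delta> \<le> grid m (Suc k) - grid m k" using delta 2 T by simp
      also have "\<dots> = w ^ 6"
        by (simp add: grid_def diff_divide_distrib[symmetric] w(5))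
      also have "\<dots> = (w ^ 3)\<^sup>2" by simp
      finally have "sqrt \<delta> \<le> w ^ 3" using w by (intro real_le_lsqrt) auto
      have c6: "1 / 2 \<le> c6"
        by (rule c6_ge_half[OF c56 T pos(3) m(1) n_bounds(1) window pos(5,1,4)])
      have "p \<le> 1" by (simp add: p_def)
      have "sqrt \<delta> \<le> w\<^sup>2" using \<open>sqrt \<delta> \<le> w ^ 3\<close> w power_decreasing[of 2 3 w] by simp
      then have "1 / 2 * sqrt \<delta> \<le> (c5 + c6) * w\<^sup>2"
        using c c6 sq w by (intro mult_mono) auto
      then have "1 / 2 \<le> (c5 + c6) / sqrt \<delta> * w\<^sup>2" using sq by (simp add: field_simps)
      then show ?thesis using \<open>p \<le> 1\<close> by linarith
    next
      case 3
      define \<delta>' where "\<delta>' = T - grid m (Suc k)"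
      \<comment> \<open>At least two steps remain at \<open>t_k\<close>, so moving on by one at most
        halves the remaining time. Only \<open>\<delta> \<le> 4 * \<delta>'\<close> is used, and the
        factor 2 under the root is absorbed by the 1/2 in \<open>p / 2\<close>.\<close>
      have "real (Suc k) + 1 \<le> real (steps T m)" using 3 by linarith
      then have "(real (steps T m) - real k) / 2 ^ (2 * m) \<le> 2 * (real (steps T m) - real (Suc k)) / 2 ^ (2 * m)"
        by (intro divide_right_mono) auto
      then have "T - grid m k \<le> 2 * \<delta>'" unfolding \<delta>'_def
        by (subst (1 2) T) (simp add: grid_def diff_divide_distrib[symmetric])
      then have d: "\<delta> \<le> 2\<^sup>2 * \<delta>'" "0 < \<delta>'"
        using delta unfolding power2_eq_square by linarith+
      then have "sqrt \<delta> \<le> sqrt (2\<^sup>2 * \<delta>')" by simp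
      then have sq': "sqrt \<delta> \<le> 2 * sqrt \<delta>'" by (simp add: real_sqrt_mult)
      have "p \<le> c5 / sqrt \<delta>' * (1 / real n) + c6 / sqrt \<delta>' / 2 ^ m"
        using c56 T d 3 m(1) n_bounds(1) window unfolding is_c5_c6_def p_def \<delta>'_def by blast
      also have "c6 / sqrt \<delta>' / 2 ^ m = c6 / sqrt \<delta>' * w ^ 3" using w(3) by (metis times_divide_eq_right mult.right_neutral)
      also have "c5 / sqrt \<delta>' * (1 / real n) + c6 / sqrt \<delta>' * w ^ 3 \<le> c5 / sqrt \<delta>' * w\<^sup>2 + c6 / sqrt \<delta>' * w\<^sup>2"
        using c d w power_decreasing[of 2 3 w] n_bounds(2) by (intro add_mono mult_left_mono) auto
      also have "\<dots> = (c5 + c6) * w\<^sup>2 / sqrt \<delta>'" by (simp add: algebra_simps add_divide_distrib)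
      also have "\<dots> \<le> (c5 + c6) * w\<^sup>2 / (sqrt \<delta> / 2)"
        using sq' sq c d by (intro divide_left_mono) auto
      finally show ?thesis by simp
    qed
  qed
  then have "p / 2 * w\<^sup>2 \<le> (c5 + c6) / sqrt \<delta> * w\<^sup>2 * w\<^sup>2" by (intro mult_right_mono) auto
  also have "\<dots> = (c5 + c6) / sqrt \<delta> * w ^ 4" by (simp add: mult.assoc flip: power_add)
  finally show "P_smooth \<mu> \<sigma> r T K m n (Suc k) y - P_disc \<mu> \<sigma> r T K m (Suc k) y
      \<le> (c5 + c6) / sqrt \<delta> * w ^ 4" .
qed

lemma a_disc_approx:
  assumes c3: "is_c3 \<mu> \<sigma> r T c3"
  shows "\<bar>a_disc \<mu> \<sigma> r T K m k x - deriv (P_smooth \<mu> \<sigma> r T K m n (Suc k)) x\<bar>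
     \<le> (2 * c3 * x + (c5 + c6) / (2 * \<sigma> * x * sqrt \<delta>)) * 2 powr (- real m / 3)"
proof -
  let ?u = "up \<mu> \<sigma> m" and ?d = "down \<mu> \<sigma> m"
  let ?S = "P_smooth \<mu> \<sigma> r T K m n (Suc k)" and ?P = "P_disc \<mu> \<sigma> r T K m (Suc k)"
  have ud: "?u - ?d = 2 * \<sigma> * w ^ 3" using up_minus_down[of \<mu> \<sigma> m] w(3) by (metis times_divide_eq_right mult.right_neutral)
  then have u: "0 \<le> ?u" using m(2) pos w by (smt (verit) mult_nonneg_nonneg zero_le_power)
  have den: "0 < (?u - ?d) * x" using ud pos w by simp
  have "a_disc \<mu> \<sigma> r T K m k x - diff_quot \<mu> \<sigma> m ?S x
     = ((?S (?d * x) - ?P (?d * x)) - (?S (?u * x) - ?P (?u * x))) / ((?u - ?d) * x)"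
    by (simp add: a_disc_def diff_quot_def diff_divide_distrib[symmetric])
  \<comment> \<open>Both smoothing errors lie between 0 and the same bound, so their difference
    costs that bound once and not twice. This yields \<open>2 * \<sigma>\<close> in the
    denominator.\<close>
  also have "\<bar>\<dots>\<bar> \<le> (c5 + c6) / sqrt \<delta> * w ^ 4 / ((?u - ?d) * x)"
    unfolding abs_divide abs_of_pos[OF den]
    using smooth_error[of "?u * x"] smooth_error[of "?d * x"] u m(2) pos den
    by (intro divide_right_mono) (auto simp: abs_le_iff)
  also have "\<dots> = (c5 + c6) / (2 * \<sigma> * x * sqrt \<delta>) * w"
    unfolding ud using w pos delta by (simp add: field_simps power_numeral_reduce)
  finally have 1: "\<bar>a_disc \<mu> \<sigma> r T K m k x - diff_quot \<mu> \<sigma> m ?S x\<bar> \<le> (c5 + c6) / (2 * \<sigma> * x * sqrt \<delta>) * w" .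
  let ?M = "SUP s\<in>{0..}. \<bar>real n * mollifier (real n * (K - s))\<bar>"
  have "grid m (Suc k) \<le> grid m (steps T m)"
    using k_less by (simp add: grid_def divide_right_mono)
  then have "grid m (Suc k) \<le> T" using T by simp
  then have "\<bar>diff_quot \<mu> \<sigma> m ?S x - deriv ?S x\<bar> \<le> c3 * ?M * x / 2 ^ m"
    using c3 C2c_smooth_put[OF n_bounds(1), of K] m pos unfolding is_c3_def P_smooth_def by blast
  also have "\<dots> = c3 * ?M * x * w ^ 3" using w(3) by (metis times_divide_eq_right mult.right_neutral)
  also have "\<dots> \<le> c3 * (2 / w\<^sup>2) * x * w ^ 3"
    using order_trans[OF SUP_second_derivative_smooth_put n_bounds(3)] c3 pos w
    by (intro mult_right_mono mult_left_mono) (auto simp: is_c3_def)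
  also have "\<dots> = 2 * c3 * x * w" using w by (simp add: field_simps power_numeral_reduce)
  finally show ?thesis using 1 unfolding w_def[symmetric] by (simp add: distrib_right)
qed

text \<open>The price terms cancel, leaving the error of \<open>a_disc\<close> times
  \<open>up * x\<close>, with a discount factor at most 1. Bounding \<open>up\<close> gives the
  first factor, and the extra \<open>x\<close> shifts the powers of \<open>x\<close> in the
  second.\<close>

lemma b_disc_approx:
  assumes c3: "is_c3 \<mu> \<sigma> r T c3"
  shows "\<bar>b_disc \<mu> \<sigma> r T K m k x
            - (P_disc \<mu> \<sigma> r T K m (Suc k) (up \<mu> \<sigma> m * x)
               - up \<mu> \<sigma> m * x * deriv (P_smooth \<mu> \<sigma> r T K m n (Suc k)) x) / rate r m ^ Suc k\<bar>
     \<le> (1 + \<sigma> / 2 ^ m + \<bar>\<mu>\<bar> / 2 ^ (2 * m))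
         * (2 * c3 * x\<^sup>2 + (c5 + c6) / (2 * \<sigma> * sqrt \<delta>)) * 2 powr (- real m / 3)"
proof -
  let ?u = "up \<mu> \<sigma> m" and ?R = "rate r m ^ Suc k"
  let ?A = "a_disc \<mu> \<sigma> r T K m k x - deriv (P_smooth \<mu> \<sigma> r T K m n (Suc k)) x"
  have R: "1 \<le> ?R" using rate_ge_1 pos by (intro one_le_power) simp
  have "?u = down \<mu> \<sigma> m + 2 * \<sigma> / 2 ^ m" using up_minus_down[of \<mu> \<sigma> m] by linarith
  then have u: "0 \<le> ?u" using m(2) pos by simp
  have "\<mu> / 2 ^ (2 * m) \<le> \<bar>\<mu>\<bar> / 2 ^ (2 * m)" by (intro divide_right_mono) auto
  then have u_le: "?u \<le> 1 + \<sigma> / 2 ^ m + \<bar>\<mu>\<bar> / 2 ^ (2 * m)" by (simp add: up_def)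
  have "b_disc \<mu> \<sigma> r T K m k x
            - (P_disc \<mu> \<sigma> r T K m (Suc k) (?u * x)
               - ?u * x * deriv (P_smooth \<mu> \<sigma> r T K m n (Suc k)) x) / ?R = - (?u * x * ?A) / ?R"
    unfolding b_disc_def diff_divide_distrib[symmetric] by (simp add: algebra_simps)
  also have "\<bar>\<dots>\<bar> = ?u * x * \<bar>?A\<bar> / ?R" using u pos R by (simp add: abs_mult abs_of_nonneg del: power_Suc)
  also have "\<dots> \<le> ?u * x * \<bar>?A\<bar>"
    using divide_left_mono[OF R, of "?u * x * \<bar>?A\<bar>"] u pos R by simp
  also have "\<dots> \<le> (1 + \<sigma> / 2 ^ m + \<bar>\<mu>\<bar> / 2 ^ (2 * m)) * x *
     ((2 * c3 * x + (c5 + c6) / (2 * \<sigma> * x * sqrt \<delta>)) * 2 powr (- real m / 3))"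
    using u u_le pos by (intro mult_mono a_disc_approx[OF c3]) auto
  also have "\<dots> = (1 + \<sigma> / 2 ^ m + \<bar>\<mu>\<bar> / 2 ^ (2 * m))
         * (x * (2 * c3 * x + (c5 + c6) / (2 * \<sigma> * x * sqrt \<delta>))) * 2 powr (- real m / 3)"
    by (simp only: mult.assoc)
  also have "x * (2 * c3 * x + (c5 + c6) / (2 * \<sigma> * x * sqrt \<delta>)) =
      2 * c3 * x\<^sup>2 + (c5 + c6) / (2 * \<sigma> * sqrt \<delta>)"
    using pos delta by (simp add: field_simps power2_eq_square)
  finally show ?thesis .
qed

end

section \<open>Convergence in law of the log-price\<close>

text \<open>A continuous mapping theorem for integrands that vary with \<open>n\<close> and whose
  limit may jump: convergence of \<open>f n (Y n)\<close> is asked along every sequence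
  \<open>Y\<close> tending to \<open>y\<close>, for almost every \<open>y\<close> under the limit
  law. As the bound holds only eventually, an initial segment is dropped before dominated
  convergence.\<close>

lemma weak_conv_integral_tendsto:
  fixes f :: "nat \<Rightarrow> real \<Rightarrow> real"
  assumes N: "\<And>n. real_distribution (N n)" "real_distribution N'" "weak_conv_m N N'"
    and meas [measurable]: "\<And>n. f n \<in> borel_measurable borel" "f' \<in> borel_measurable borel"
    and bound: "eventually (\<lambda>n. \<forall>y. \<bar>f n y\<bar> \<le> C) sequentially"
    and conv: "AE y in N'. \<forall>Y. Y \<longlonglongrightarrow> y \<longrightarrow> (\<lambda>n. f n (Y n)) \<longlonglongrightarrow> f' y"
  shows "(\<lambda>n. \<integral>y. f n y \<partial>N n) \<longlonglongrightarrow> (\<integral>y. f' y \<partial>N')"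
proof -
  obtain \<Omega> :: "real measure" and Y_seq Y where \<Omega>: "prob_space \<Omega>"
    and [measurable]: "\<And>n. Y_seq n \<in> measurable \<Omega> borel" and Y: "Y \<in> measurable \<Omega> lborel"
    and dist: "\<And>n. distr \<Omega> borel (Y_seq n) = N n" "distr \<Omega> borel Y = N'"
    and lim: "\<And>x. x \<in> space \<Omega> \<Longrightarrow> (\<lambda>n. Y_seq n x) \<longlonglongrightarrow> Y x"
    using Skorohod[OF N] by blast
  interpret prob_space \<Omega> by (rule \<Omega>)
  have [measurable]: "Y \<in> borel_measurable \<Omega>" using Y by simp
  obtain n0 where n0: "\<And>n y. n0 \<le> n \<Longrightarrow> \<bar>f n y\<bar> \<le> C"
    using bound unfolding eventually_sequentially by blast
  have "AE x in \<Omega>. \<forall>Z. Z \<longlonglongrightarrow> Y x \<longrightarrow> (\<lambda>n. f n (Z n)) \<longlonglongrightarrow> f' (Y x)"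
    using conv unfolding dist(2)[symmetric] by (rule AE_distrD[rotated]) simp
  then have AE: "AE x in \<Omega>. (\<lambda>n. f n (Y_seq n x)) \<longlonglongrightarrow> f' (Y x)"
    using AE_space by eventually_elim (use lim in blast)
  have "(\<lambda>n. \<integral>x. f (n + n0) (Y_seq (n + n0) x) \<partial>\<Omega>) \<longlonglongrightarrow> (\<integral>x. f' (Y x) \<partial>\<Omega>)"
  proof (rule integral_dominated_convergence[where w = "\<lambda>_. C"])
    show "AE x in \<Omega>. (\<lambda>n. f (n + n0) (Y_seq (n + n0) x)) \<longlonglongrightarrow> f' (Y x)"
      using AE by eventually_elim (rule LIMSEQ_ignore_initial_segment)
    show "AE x in \<Omega>. norm (f (n + n0) (Y_seq (n + n0) x)) \<le> C" for n
      using n0 by simp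
  qed simp_all
  then have "(\<lambda>n. \<integral>x. f n (Y_seq n x) \<partial>\<Omega>) \<longlonglongrightarrow> (\<integral>x. f' (Y x) \<partial>\<Omega>)"
    by (rule LIMSEQ_offset)
  then show ?thesis
    unfolding dist[symmetric] by (simp add: integral_distr)
qed

text \<open>Logarithms make the characteristic function a \<open>j\<close>-th power. The law
  describes the price ratio when \<open>up\<close> and \<open>down\<close> are positive, which holds
  for large \<open>m\<close>.\<close>

definition log_law :: "real \<Rightarrow> real \<Rightarrow> real \<Rightarrow> nat \<Rightarrow> nat \<Rightarrow> real measure" where
  "log_law \<mu> \<sigma> r m j = distr (measure_pmf (binomial_pmf j (q_up \<mu> \<sigma> r m))) borel
     (\<lambda>i. real i * ln (up \<mu> \<sigma> m) + real (j - i) * ln (down \<mu> \<sigma> m))"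

text \<open>An image of the standard normal law and not a density, so that \<open>\<tau> = 0\<close>
  is included as the point mass at 0.\<close>

definition bs_log_law :: "real \<Rightarrow> real \<Rightarrow> real \<Rightarrow> real measure" where
  "bs_log_law \<sigma> r \<tau> = distr std_normal_distribution borel
     (\<lambda>z. (r - \<sigma>\<^sup>2 / 2) * \<tau> + \<sigma> * sqrt \<tau> * z)"

lemma real_distribution_log_law: "real_distribution (log_law \<mu> \<sigma> r m j)"
  unfolding log_law_def by (rule prob_space.real_distribution_distr[OF prob_space_measure_pmf]) simp

lemma real_distribution_bs_log_law: "real_distribution (bs_log_law \<sigma> r \<tau>)"
proof -
  interpret real_distribution std_normal_distribution by (rule real_dist_normal_dist)
  show ?thesis unfolding bs_log_law_def by (rule real_distribution_distr) simp
qed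

lemma char_log_law:
  assumes "q_up \<mu> \<sigma> r m \<in> {0..1}"
  shows "char (log_law \<mu> \<sigma> r m j) t =
    (of_real (q_up \<mu> \<sigma> r m) * iexp (t * ln (up \<mu> \<sigma> m))
      + of_real (q_down \<mu> \<sigma> r m) * iexp (t * ln (down \<mu> \<sigma> m))) ^ j"
proof -
  let ?q = "q_up \<mu> \<sigma> r m" and ?a = "ln (up \<mu> \<sigma> m)" and ?b = "ln (down \<mu> \<sigma> m)"
  have e: "iexp (t * (real i * ?a + real l * ?b)) = iexp (t * ?a) ^ i * iexp (t * ?b) ^ l" for i l
    by (simp add: exp_of_nat_mult[symmetric] exp_add[symmetric] algebra_simps)
  have "char (log_law \<mu> \<sigma> r m j) t =
    (\<Sum>i\<le>j. (real (j choose i) * ?q ^ i * (1 - ?q) ^ (j - i)) *\<^sub>R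
       (iexp (t * ?a) ^ i * iexp (t * ?b) ^ (j - i)))"
    unfolding char_def log_law_def
    by (subst integral_distr) (simp_all only: expectation_binomial_pmf'[OF assms] e, simp_all)
  also have "\<dots> = (of_real ?q * iexp (t * ?a) + of_real (1 - ?q) * iexp (t * ?b)) ^ j"
    unfolding binomial_ring
    by (intro sum.cong refl) (simp add: scaleR_conv_of_real power_mult_distrib mult_ac)
  finally show ?thesis by (simp add: q_down_eq)
qed

lemma char_bs_log_law:
  assumes "0 \<le> \<tau>"
  shows "char (bs_log_law \<sigma> r \<tau>) t =
    exp (of_real \<tau> * (\<i> * of_real (t * (r - \<sigma>\<^sup>2 / 2)) - of_real (t\<^sup>2 * \<sigma>\<^sup>2 / 2)))"
proof -
  let ?c = "(r - \<sigma>\<^sup>2 / 2) * \<tau>" and ?s = "\<sigma> * sqrt \<tau>"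
  have "char (bs_log_law \<sigma> r \<tau>) t = (CLINT z|std_normal_distribution. iexp (t * (?c + ?s * z)))"
    unfolding char_def bs_log_law_def by (subst integral_distr) simp_all
  also have "\<dots> = (CLINT z|std_normal_distribution. iexp (t * ?c) * iexp ((t * ?s) * z))"
    by (simp add: exp_add[symmetric] algebra_simps)
  also have "\<dots> = iexp (t * ?c) * char std_normal_distribution (t * ?s)"
    unfolding char_def by (rule integral_mult_right_zero)
  also have "\<dots> = iexp (t * ?c) * exp (of_real (- (t * ?s)\<^sup>2 / 2))"
    by (simp only: char_std_normal_distribution exp_of_real)
  also have "(t * ?s)\<^sup>2 = \<tau> * (t\<^sup>2 * \<sigma>\<^sup>2)"
    using assms by (simp add: power_mult_distrib)
  also have "iexp (t * ?c) * exp (of_real (- (\<tau> * (t\<^sup>2 * \<sigma>\<^sup>2)) / 2)) =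
    exp (of_real \<tau> * (\<i> * of_real (t * (r - \<sigma>\<^sup>2 / 2)) - of_real (t\<^sup>2 * \<sigma>\<^sup>2 / 2)))"
    by (simp add: exp_add[symmetric] algebra_simps)
  finally show ?thesis .
qed

text \<open>With \<open>e = 2^-m\<close>, the bias of \<open>q_up\<close> turns the drift
  \<open>\<mu> - \<sigma>^2/2\<close> of the logarithm into \<open>r - \<sigma>^2/2\<close> and
  leaves the leading variance \<open>\<sigma>^2 * e^2\<close>. So one binomial step agrees with one
  Gaussian step of length \<open>e^2\<close> up to \<open>o(e^2)\<close>; \<open>lam\<close> is the
  characteristic exponent of the limit.\<close>

lemma one_step_char_expansion:
  fixes \<mu> \<sigma> r t :: real
  defines "lam \<equiv> \<i> * of_real (t * (r - \<sigma>\<^sup>2 / 2)) - of_real (t\<^sup>2 * \<sigma>\<^sup>2 / 2)"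
  assumes \<sigma>: "0 < \<sigma>"
  shows "(\<lambda>m. (of_real (q_up \<mu> \<sigma> r m) * iexp (t * ln (up \<mu> \<sigma> m))
      + of_real (q_down \<mu> \<sigma> r m) * iexp (t * ln (down \<mu> \<sigma> m))
      - exp (lam / 2 ^ (2 * m))) * 2 ^ (2 * m)) \<longlonglongrightarrow> 0" (is "?E \<longlonglongrightarrow> 0")
proof -
  \<comment> \<open>The real and imaginary parts as real functions of \<open>e\<close>, to which
    real asymptotic expansion at 0 from the right applies.\<close>
  define R where "R = (\<lambda>e. ((1/2+1/2*((r-\<mu>)/\<sigma>)*e) * cos (t * ln (1+\<sigma>*e+\<mu>*e^2))
     + (1/2-1/2*((r-\<mu>)/\<sigma>)*e) * cos (t * ln (1-\<sigma>*e+\<mu>*e^2))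
     - exp (- (e^2 * (t^2*\<sigma>^2/2))) * cos (e^2 * (t * (r-\<sigma>^2/2)))) / e^2)"
  define I where "I = (\<lambda>e. ((1/2+1/2*((r-\<mu>)/\<sigma>)*e) * sin (t * ln (1+\<sigma>*e+\<mu>*e^2))
     + (1/2-1/2*((r-\<mu>)/\<sigma>)*e) * sin (t * ln (1-\<sigma>*e+\<mu>*e^2))
     - exp (- (e^2 * (t^2*\<sigma>^2/2))) * sin (e^2 * (t * (r-\<sigma>^2/2)))) / e^2)"
  have lim: "(R \<longlongrightarrow> 0) (at_right 0)" "(I \<longlongrightarrow> 0) (at_right 0)"
    unfolding R_def I_def using \<sigma> by (real_asymp simp: field_simps power2_eq_square)+
  have e: "filterlim (\<lambda>m. 1 / 2 ^ m :: real) (at_right 0) sequentially"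
    by real_asymp
  have sq: "(1 / 2 ^ m)\<^sup>2 = (1 / 2 ^ (2 * m) :: real)" for m
    by (simp add: power_double_eq_square power_divide)
  have "Re (?E m) = R (1 / 2 ^ m)" for m
    unfolding R_def q_up_def q_down_def up_def down_def sq lam_def
    by (simp add: Re_exp Im_exp algebra_simps diff_divide_distrib)
  moreover have "Im (?E m) = I (1 / 2 ^ m)" for m
    unfolding I_def q_up_def q_down_def up_def down_def sq lam_def
    by (simp add: Re_exp Im_exp algebra_simps diff_divide_distrib)
  ultimately show ?thesis
    unfolding tendsto_complex_iff
    using filterlim_compose[OF lim(1) e] filterlim_compose[OF lim(2) e] by simp
qed

lemma eventually_q_up:
  assumes "0 < \<sigma>"
  shows "eventually (\<lambda>m. q_up \<mu> \<sigma> r m \<in> {0..1}) sequentially"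
proof -
  have "(\<lambda>m. q_up \<mu> \<sigma> r m) \<longlonglongrightarrow> 1 / 2" unfolding q_up_def by real_asymp
  then have "eventually (\<lambda>m. 0 < q_up \<mu> \<sigma> r m \<and> q_up \<mu> \<sigma> r m < 1) sequentially"
    by (intro eventually_conj order_tendstoD) auto
  then show ?thesis by eventually_elim simp
qed

lemma weak_conv_log_law:
  assumes \<sigma>: "0 < \<sigma>" and \<tau>: "0 \<le> \<tau>" and m: "filterlim m at_top sequentially"
    and j: "(\<lambda>i. real (j i) / 2 ^ (2 * m i)) \<longlonglongrightarrow> \<tau>"
  shows "weak_conv_m (\<lambda>i. log_law \<mu> \<sigma> r (m i) (j i)) (bs_log_law \<sigma> r \<tau>)"
proof (rule levy_continuity)
  show "real_distribution (log_law \<mu> \<sigma> r (m i) (j i))" for i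
    by (rule real_distribution_log_law)
  show "real_distribution (bs_log_law \<sigma> r \<tau>)" by (rule real_distribution_bs_log_law)
  fix t
  define lam where "lam = \<i> * of_real (t * (r - \<sigma>\<^sup>2 / 2)) - of_real (t\<^sup>2 * \<sigma>\<^sup>2 / 2)"
  define w where "w = (\<lambda>m. of_real (q_up \<mu> \<sigma> r m) * iexp (t * ln (up \<mu> \<sigma> m))
      + of_real (q_down \<mu> \<sigma> r m) * iexp (t * ln (down \<mu> \<sigma> m)))"
  define v where "v = (\<lambda>m. exp (lam / 2 ^ (2 * m)))"
  have Re: "Re (lam / 2 ^ (2 * n)) \<le> 0" for n
  proof -
    have "lam / 2 ^ (2 * n) = of_real (1 / 2 ^ (2 * n)) * lam" by simp
    then have "Re (lam / 2 ^ (2 * n)) = 1 / 2 ^ (2 * n) * Re lam" by simp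
    then show ?thesis by (simp add: lam_def mult_nonneg_nonpos)
  qed
  have v1: "norm (v n) \<le> 1" for n
    using Re by (simp add: v_def norm_exp_eq_Re)
  have w1: "norm (w n) \<le> 1" if "q_up \<mu> \<sigma> r n \<in> {0..1}" for n
  proof -
    have "norm (w n) \<le> norm (of_real (q_up \<mu> \<sigma> r n) * iexp (t * ln (up \<mu> \<sigma> n)))
       + norm (of_real (q_down \<mu> \<sigma> r n) * iexp (t * ln (down \<mu> \<sigma> n)))"
      unfolding w_def by (rule norm_triangle_ineq)
    also have "\<dots> = q_up \<mu> \<sigma> r n + (1 - q_up \<mu> \<sigma> r n)"
    proof -
      have "\<bar>q_up \<mu> \<sigma> r n\<bar> = q_up \<mu> \<sigma> r n" "\<bar>q_down \<mu> \<sigma> r n\<bar> = 1 - q_up \<mu> \<sigma> r n"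
        using that by (auto simp: q_down_eq)
      then show ?thesis by (simp add: norm_mult)
    qed
    finally show ?thesis by simp
  qed
  have q: "eventually (\<lambda>i. q_up \<mu> \<sigma> r (m i) \<in> {0..1}) sequentially"
    using eventually_q_up[OF \<sigma>] m by (rule eventually_compose_filterlim)
  have E: "(\<lambda>i. (w (m i) - v (m i)) * 2 ^ (2 * m i)) \<longlonglongrightarrow> 0"
    using filterlim_compose[OF one_step_char_expansion[OF \<sigma>, of \<mu> r t] m]
    by (simp add: w_def v_def lam_def)
  have "(\<lambda>i. w (m i) ^ j i - v (m i) ^ j i) \<longlonglongrightarrow> 0"
  proof (rule Lim_null_comparison)
    show "eventually (\<lambda>i. norm (w (m i) ^ j i - v (m i) ^ j i) \<le>
       real (j i) / 2 ^ (2 * m i) * norm ((w (m i) - v (m i)) * 2 ^ (2 * m i))) sequentially"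
      using q
    proof eventually_elim
      case (elim i)
      have "norm (w (m i) ^ j i - v (m i) ^ j i) \<le> real (j i) * norm (w (m i) - v (m i))"
        by (rule norm_power_diff[OF w1[OF elim] v1])
      then show ?case by (simp add: norm_mult norm_power)
    qed
    show "(\<lambda>i. real (j i) / 2 ^ (2 * m i) * norm ((w (m i) - v (m i)) * 2 ^ (2 * m i))) \<longlonglongrightarrow> 0"
      using tendsto_mult[OF j tendsto_norm_zero[OF E]] by simp
  qed
  moreover have "(\<lambda>i. v (m i) ^ j i) \<longlonglongrightarrow> exp (of_real \<tau> * lam)"
  proof -
    have "v (m i) ^ j i = exp (of_real (real (j i) / 2 ^ (2 * m i)) * lam)" for i
      by (simp add: v_def exp_of_nat_mult[symmetric])
    then show ?thesis by (simp only:) (intro tendsto_intros j)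
  qed
  ultimately have "(\<lambda>i. w (m i) ^ j i - v (m i) ^ j i + v (m i) ^ j i) \<longlonglongrightarrow> 0 + exp (of_real \<tau> * lam)"
    by (rule tendsto_add)
  then have lim: "(\<lambda>i. w (m i) ^ j i) \<longlonglongrightarrow> char (bs_log_law \<sigma> r \<tau>) t"
    using char_bs_log_law[OF \<tau>] by (simp add: lam_def)
  have ev: "eventually (\<lambda>i. w (m i) ^ j i = char (log_law \<mu> \<sigma> r (m i) (j i)) t) sequentially"
    using q by eventually_elim (simp only: w_def char_log_law)
  show "(\<lambda>i. char (log_law \<mu> \<sigma> r (m i) (j i)) t) \<longlonglongrightarrow> char (bs_log_law \<sigma> r \<tau>) t"
    using lim by (rule Lim_transform_eventually) (rule ev)
qed

lemma weak_conv_bs_log_law: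
  assumes "\<And>i. 0 \<le> \<tau>s i" "\<tau>s \<longlonglongrightarrow> \<tau>"
  shows "weak_conv_m (\<lambda>i. bs_log_law \<sigma> r (\<tau>s i)) (bs_log_law \<sigma> r \<tau>)"
proof (rule levy_continuity)
  have "0 \<le> \<tau>" using assms by (intro LIMSEQ_le_const[OF assms(2)]) auto
  then show "(\<lambda>i. char (bs_log_law \<sigma> r (\<tau>s i)) t) \<longlonglongrightarrow> char (bs_log_law \<sigma> r \<tau>) t" for t
    using assms(1) by (simp only: char_bs_log_law) (intro tendsto_intros assms(2))
qed (rule real_distribution_bs_log_law)+

lemma AE_bs_log_law_neq:
  assumes "0 < \<sigma>" "0 \<le> \<tau>" "0 < \<tau> \<or> x \<noteq> K" "0 < x" "0 < K"
  shows "AE l in bs_log_law \<sigma> r \<tau>. x * exp l \<noteq> K"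
proof -
  have "AE z in lborel. x * exp ((r - \<sigma>\<^sup>2 / 2) * \<tau> + \<sigma> * sqrt \<tau> * z) \<noteq> K"
  proof (cases "\<tau> = 0")
    case False
    then have s: "\<sigma> * sqrt \<tau> \<noteq> 0" using assms by simp
    show ?thesis
      using AE_lborel_singleton[of "(ln (K / x) - (r - \<sigma>\<^sup>2 / 2) * \<tau>) / (\<sigma> * sqrt \<tau>)"]
    proof eventually_elim
      case (elim z)
      show ?case
      proof
        assume "x * exp ((r - \<sigma>\<^sup>2 / 2) * \<tau> + \<sigma> * sqrt \<tau> * z) = K"
        then have "exp ((r - \<sigma>\<^sup>2 / 2) * \<tau> + \<sigma> * sqrt \<tau> * z) = K / x" using assms(4) by (simp add: field_simps)
        then have "(r - \<sigma>\<^sup>2 / 2) * \<tau> + \<sigma> * sqrt \<tau> * z = ln (K / x)" by (metis ln_exp)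
        then show False using elim s by (simp add: nonzero_eq_divide_eq mult.commute)
      qed
    qed
  qed (use assms in simp)
  then have "AE z in std_normal_distribution. x * exp ((r - \<sigma>\<^sup>2 / 2) * \<tau> + \<sigma> * sqrt \<tau> * z) \<noteq> K"
    by (subst AE_density) (auto elim: eventually_mono)
  then show ?thesis
    unfolding bs_log_law_def by (subst AE_distr_iff) simp_all
qed

section \<open>Limits of price and hedge ratio\<close>

text \<open>The payoff is 1-Lipschitz, so the quotient is at most \<open>Z\<close>; it is nonzero
  only if the lower of the two prices is below \<open>K\<close>, and then
  \<open>Z \<le> K / c\<close>. A bound free of \<open>Z\<close> is what dominated convergence needs
  for the unbounded \<open>exp l\<close>.\<close>

lemma put_slope_bound:
  assumes "0 < c" "c \<le> a" "c \<le> b" "a \<noteq> b" "0 < Z" "0 < K"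
  shows "\<bar>(put K (b * Z) - put K (a * Z)) / (b - a)\<bar> \<le> K / c"
proof -
  have *: "\<bar>put K (b * Z) - put K (a * Z)\<bar> \<le> K / c * (b - a)" if "a < b" "c \<le> a" for a b
  proof (cases "a * Z < K")
    case True
    have "c * Z \<le> a * Z" using that assms by (intro mult_right_mono) auto
    then have "c * Z \<le> K" using True by linarith
    then have Z: "Z \<le> K / c" using assms by (simp add: field_simps)
    have "a * Z \<le> b * Z" using that assms by (intro mult_right_mono) auto
    then have "\<bar>put K (b * Z) - put K (a * Z)\<bar> \<le> b * Z - a * Z"
      unfolding put_def by linarith
    also have "\<dots> = Z * (b - a)" by (simp add: algebra_simps)
    also have "\<dots> \<le> K / c * (b - a)" using Z that by (intro mult_right_mono) auto
    finally show ?thesis .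
  next
    case False
    have "a * Z \<le> b * Z" using that assms by (intro mult_right_mono) auto
    then have "put K (b * Z) - put K (a * Z) = 0" using False by (simp add: put_def)
    then show ?thesis using that assms by simp
  qed
  consider "a < b" | "b < a" using assms by linarith
  then show ?thesis
  proof cases
    case 1
    then show ?thesis using *[of a b] assms by (simp add: pos_divide_le_eq)
  next
    case 2
    have "(put K (b * Z) - put K (a * Z)) / (b - a) = (put K (a * Z) - put K (b * Z)) / (a - b)"
      using 2 by (simp add: field_simps)
    then show ?thesis using *[of b a] 2 assms by (simp add: pos_divide_le_eq)
  qed
qed

lemma put_slope_tendsto:
  assumes a: "a \<longlonglongrightarrow> x" and b: "b \<longlonglongrightarrow> x" and ne: "eventually (\<lambda>n. a n \<noteq> b n) sequentially"
    and Z: "Z \<longlonglongrightarrow> z" and xz: "x * z \<noteq> K"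
  shows "(\<lambda>n. (put K (b n * Z n) - put K (a n * Z n)) / (b n - a n)) \<longlonglongrightarrow> (if x * z < K then - z else 0)"
proof -
  have lim: "(\<lambda>n. a n * Z n) \<longlonglongrightarrow> x * z" "(\<lambda>n. b n * Z n) \<longlonglongrightarrow> x * z"
    by (intro tendsto_mult a b Z)+
  show ?thesis
  proof (cases "x * z < K")
    case True
    have "eventually (\<lambda>n. - Z n = (put K (b n * Z n) - put K (a n * Z n)) / (b n - a n)) sequentially"
      using order_tendstoD(2)[OF lim(1) True] order_tendstoD(2)[OF lim(2) True] ne
      by eventually_elim (simp add: put_def field_simps)
    with tendsto_minus[OF Z] show ?thesis using True by (simp add: Lim_transform_eventually)
  next
    case False
    then have K: "K < x * z" using xz by simp
    have "eventually (\<lambda>n. 0 = (put K (b n * Z n) - put K (a n * Z n)) / (b n - a n)) sequentially"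
      using order_tendstoD(1)[OF lim(1) K] order_tendstoD(1)[OF lim(2) K]
      by eventually_elim (simp add: put_def)
    with tendsto_const[of 0 sequentially] show ?thesis using False
      by (simp only: if_False) (rule Lim_transform_eventually)
  qed
qed

lemma borel_measurable_put [measurable]:
  "f \<in> borel_measurable N \<Longrightarrow> (\<lambda>x. put K (f x)) \<in> borel_measurable N"
  unfolding put_def by measurable

lemma put_exp_bound: "0 < y \<Longrightarrow> 0 < K \<Longrightarrow> \<bar>put K (y * exp l)\<bar> \<le> K"
  by (simp add: put_def)

lemma integrable_put_exp:
  assumes "real_distribution N" "0 < y" "0 < K"
  shows "integrable N (\<lambda>l. put K (y * exp l))"
proof -
  interpret real_distribution N by fact
  show ?thesis using put_exp_bound[OF assms(2,3)] by (intro integrable_const_bound[of _ K]) auto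
qed

lemma integral_put_tendsto:
  assumes N: "\<And>n. real_distribution (N n)" "real_distribution N'" "weak_conv_m N N'"
    and y: "y \<longlonglongrightarrow> x" "0 < x" "0 < K"
  shows "(\<lambda>n. \<integral>l. put K (y n * exp l) \<partial>N n) \<longlonglongrightarrow> (\<integral>l. put K (x * exp l) \<partial>N')"
proof (rule weak_conv_integral_tendsto[OF N, where C = K])
  show "eventually (\<lambda>n. \<forall>l. \<bar>put K (y n * exp l)\<bar> \<le> K) sequentially"
    using order_tendstoD(1)[OF y(1,2)] by eventually_elim (use put_exp_bound y(3) in blast)
  show "AE l in N'. \<forall>Y. Y \<longlonglongrightarrow> l \<longrightarrow> (\<lambda>n. put K (y n * exp (Y n))) \<longlonglongrightarrow> put K (x * exp l)"
    unfolding put_def by (intro AE_I2 allI impI tendsto_intros y)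
qed measurable

text \<open>Serves twice: with binomial laws and nodes \<open>down * x\<close>,
  \<open>up * x\<close> for the discrete hedge ratio, and with a constant law for the derivative of
  the limiting price. Both limits are therefore the same integral.\<close>

lemma integral_put_slope_tendsto:
  assumes N: "\<And>n. real_distribution (N n)" "real_distribution N'" "weak_conv_m N N'"
    and a: "a \<longlonglongrightarrow> x" and b: "b \<longlonglongrightarrow> x" and ne: "eventually (\<lambda>n. a n \<noteq> b n) sequentially"
    and x: "0 < x" "0 < K" and AE: "AE l in N'. x * exp l \<noteq> K"
  shows "(\<lambda>n. ((\<integral>l. put K (b n * exp l) \<partial>N n) - (\<integral>l. put K (a n * exp l) \<partial>N n)) / (b n - a n))
    \<longlonglongrightarrow> (\<integral>l. (if x * exp l < K then - exp l else 0) \<partial>N')"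
proof -
  have pos: "eventually (\<lambda>n. x / 2 < a n \<and> x / 2 < b n \<and> a n \<noteq> b n) sequentially"
    using order_tendstoD(1)[OF a, of "x / 2"] order_tendstoD(1)[OF b, of "x / 2"] ne x
    by (simp add: eventually_conj_iff)
  have "(\<lambda>n. \<integral>l. (put K (b n * exp l) - put K (a n * exp l)) / (b n - a n) \<partial>N n)
    \<longlonglongrightarrow> (\<integral>l. (if x * exp l < K then - exp l else 0) \<partial>N')"
  proof (rule weak_conv_integral_tendsto[OF N, where C = "K / (x / 2)"])
    show "eventually (\<lambda>n. \<forall>l. \<bar>(put K (b n * exp l) - put K (a n * exp l)) / (b n - a n)\<bar> \<le> K / (x / 2)) sequentially"
      using pos by eventually_elim (intro allI put_slope_bound; use x in simp)
    show "AE l in N'. \<forall>Y. Y \<longlonglongrightarrow> l \<longrightarrow>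
      (\<lambda>n. (put K (b n * exp (Y n)) - put K (a n * exp (Y n))) / (b n - a n))
         \<longlonglongrightarrow> (if x * exp l < K then - exp l else 0)"
      using AE by eventually_elim (intro allI impI put_slope_tendsto a b ne tendsto_exp)
  qed measurable
  moreover have "eventually (\<lambda>n. (\<integral>l. (put K (b n * exp l) - put K (a n * exp l)) / (b n - a n) \<partial>N n)
      = ((\<integral>l. put K (b n * exp l) \<partial>N n) - (\<integral>l. put K (a n * exp l) \<partial>N n)) / (b n - a n)) sequentially"
    using pos
  proof eventually_elim
    case (elim n)
    then have "0 < a n" "0 < b n" using x by auto
    then show ?case
      using integrable_put_exp[OF N(1)] x by (simp add: Bochner_Integration.integral_diff)
  qed
  ultimately show ?thesis by (rule Lim_transform_eventually)
qed

section \<open>The Black--Scholes price and its slope\<close>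

definition bs_value :: "real \<Rightarrow> real \<Rightarrow> real \<Rightarrow> real \<Rightarrow> real \<Rightarrow> real" where
  "bs_value \<sigma> r K \<tau> x = (\<integral>l. put K (x * exp l) \<partial>bs_log_law \<sigma> r \<tau>) / exp (r * \<tau>)"

text \<open>The payoff is differentiated in \<open>x\<close> under the expectation. Unlike
  \<open>deriv\<close>, this integral passes directly to the limit in \<open>\<tau>\<close> and
  \<open>x\<close>.\<close>

definition bs_slope :: "real \<Rightarrow> real \<Rightarrow> real \<Rightarrow> real \<Rightarrow> real \<Rightarrow> real" where
  "bs_slope \<sigma> r K \<tau> x = (\<integral>l. (if x * exp l < K then - exp l else 0) \<partial>bs_log_law \<sigma> r \<tau>) / exp (r * \<tau>)"

lemma bs_value_tendsto:
  assumes "\<And>i. 0 \<le> \<tau>s i" "\<tau>s \<longlonglongrightarrow> \<tau>" "xs \<longlonglongrightarrow> x" "0 < x" "0 < K"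
  shows "(\<lambda>i. bs_value \<sigma> r K (\<tau>s i) (xs i)) \<longlonglongrightarrow> bs_value \<sigma> r K \<tau> x"
  unfolding bs_value_def
  by (intro tendsto_divide integral_put_tendsto real_distribution_bs_log_law weak_conv_bs_log_law
      tendsto_exp tendsto_mult tendsto_const assms exp_not_eq_zero)

text \<open>The corner \<open>\<tau> = 0\<close>, \<open>x = K\<close> is excluded, since at
  maturity the slope jumps from -1 to 0 across the strike. Elsewhere the integrand converges almost
  surely, and \<open>exp l\<close> is dominated because \<open>xs i * exp l < K\<close> on the
  relevant set.\<close>

lemma bs_slope_tendsto:
  assumes \<tau>: "\<And>i. 0 \<le> \<tau>s i" "\<tau>s \<longlonglongrightarrow> \<tau>" and x: "xs \<longlonglongrightarrow> x" "0 < x" "0 < K"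
    and \<sigma>: "0 < \<sigma>" and ne: "0 < \<tau> \<or> x \<noteq> K"
  shows "(\<lambda>i. bs_slope \<sigma> r K (\<tau>s i) (xs i)) \<longlonglongrightarrow> bs_slope \<sigma> r K \<tau> x"
proof -
  have \<tau>0: "0 \<le> \<tau>" using \<tau> by (intro LIMSEQ_le_const[OF \<tau>(2)]) auto
  have "(\<lambda>i. \<integral>l. (if xs i * exp l < K then - exp l else 0) \<partial>bs_log_law \<sigma> r (\<tau>s i))
     \<longlonglongrightarrow> (\<integral>l. (if x * exp l < K then - exp l else 0) \<partial>bs_log_law \<sigma> r \<tau>)"
  proof (rule weak_conv_integral_tendsto[OF real_distribution_bs_log_law real_distribution_bs_log_law
        weak_conv_bs_log_law[OF \<tau>], where C = "K / (x / 2)"])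
    show "eventually (\<lambda>i. \<forall>l. \<bar>if xs i * exp l < K then - exp l else 0\<bar> \<le> K / (x / 2)) sequentially"
    proof -
      have "eventually (\<lambda>i. x / 2 < xs i) sequentially"
        using x by (intro order_tendstoD(1)[OF x(1)]) simp
      then show ?thesis
      proof (eventually_elim, intro allI)
        fix i l assume xi: "x / 2 < xs i"
        show "\<bar>if xs i * exp l < K then - exp l else 0\<bar> \<le> K / (x / 2)"
        proof (cases "xs i * exp l < K")
          case True
          have "x / 2 * exp l \<le> xs i * exp l" using xi by (intro mult_right_mono) auto
          then have "exp l * (x / 2) \<le> K" unfolding mult.commute[of "exp l"] using True by linarith
          then show ?thesis using True x by (simp add: pos_le_divide_eq)
        qed (use x in simp)
      qed
    qed
    show "AE l in bs_log_law \<sigma> r \<tau>. \<forall>Y. Y \<longlonglongrightarrow> l \<longrightarrow>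
       (\<lambda>i. if xs i * exp (Y i) < K then - exp (Y i) else 0) \<longlonglongrightarrow> (if x * exp l < K then - exp l else 0)"
      using AE_bs_log_law_neq[OF \<sigma> \<tau>0 ne x(2,3)]
    proof (eventually_elim, intro allI impI)
      fix l :: real and Y assume ne: "x * exp l \<noteq> K" and Y: "Y \<longlonglongrightarrow> l"
      have lim: "(\<lambda>i. xs i * exp (Y i)) \<longlonglongrightarrow> x * exp l" by (intro tendsto_intros x Y)
      show "(\<lambda>i. if xs i * exp (Y i) < K then - exp (Y i) else 0) \<longlonglongrightarrow> (if x * exp l < K then - exp l else 0)"
      proof (cases "x * exp l < K")
        case True
        have "eventually (\<lambda>i. - exp (Y i) = (if xs i * exp (Y i) < K then - exp (Y i) else 0)) sequentially"
          using order_tendstoD(2)[OF lim True] by eventually_elim simp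
        with tendsto_minus[OF tendsto_exp[OF Y]] show ?thesis using True by (simp add: Lim_transform_eventually)
      next
        case False
        then have "K < x * exp l" using ne by simp
        have "eventually (\<lambda>i. 0 = (if xs i * exp (Y i) < K then - exp (Y i) else 0)) sequentially"
          using order_tendstoD(1)[OF lim \<open>K < x * exp l\<close>] by eventually_elim simp
        with tendsto_const[of 0 sequentially] show ?thesis using False
          by (simp only: if_False) (rule Lim_transform_eventually)
      qed
    qed
  qed measurable
  then show ?thesis
    unfolding bs_slope_def by (intro tendsto_divide tendsto_intros \<tau>) auto
qed

lemma bs_value_has_derivative:
  assumes "0 < \<sigma>" "0 \<le> \<tau>" "0 < x" "0 < K" "0 < \<tau> \<or> x \<noteq> K"
  shows "(bs_value \<sigma> r K \<tau> has_real_derivative bs_slope \<sigma> r K \<tau> x) (at x)"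
  unfolding has_field_derivative_iff tendsto_at_iff_sequentially comp_def
proof (intro allI impI)
  fix X assume ne: "\<forall>i. X i \<in> UNIV - {x}" and X: "X \<longlonglongrightarrow> x"
  let ?N = "bs_log_law \<sigma> r \<tau>"
  have weak: "weak_conv_m (\<lambda>i. ?N) ?N"
    using weak_conv_bs_log_law[of "\<lambda>_. \<tau>" \<tau>] assms by simp
  have "(\<lambda>n. ((\<integral>l. put K (X n * exp l) \<partial>?N) - (\<integral>l. put K (x * exp l) \<partial>?N)) / (X n - x))
    \<longlonglongrightarrow> (\<integral>l. (if x * exp l < K then - exp l else 0) \<partial>?N)"
    using ne by (intro integral_put_slope_tendsto real_distribution_bs_log_law weak X assms
      AE_bs_log_law_neq tendsto_const) (auto intro: always_eventually)
  then have "(\<lambda>n. ((\<integral>l. put K (X n * exp l) \<partial>?N) - (\<integral>l. put K (x * exp l) \<partial>?N)) / (X n - x) / exp (r * \<tau>))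
    \<longlonglongrightarrow> bs_slope \<sigma> r K \<tau> x"
    unfolding bs_slope_def by (intro tendsto_divide tendsto_const) auto
  then show "(\<lambda>n. (bs_value \<sigma> r K \<tau> (X n) - bs_value \<sigma> r K \<tau> x) / (X n - x)) \<longlonglongrightarrow> bs_slope \<sigma> r K \<tau> x"
    by (simp add: bs_value_def diff_divide_distrib mult.commute)
qed

section \<open>Expectations over Brownian motion\<close>

lemma standard_BM_distributed:
  assumes "standard_BM M W" "0 < t"
  shows "distributed M lborel (\<lambda>\<omega>. W t \<omega> - W 0 \<omega>) (normal_density 0 (sqrt t))"
proof -
  have "\<forall>s t. 0 \<le> s \<and> s < t \<longrightarrow>
      distributed M lborel (\<lambda>\<omega>. W t \<omega> - W s \<omega>) (normal_density 0 (sqrt (t - s)))"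
    using assms(1) unfolding standard_BM_def by (elim conjE) assumption
  from this[rule_format, of 0 t] show ?thesis using assms(2) by simp
qed

text \<open>\<open>standard_BM\<close> gives densities only for increments over positive time spans,
  and \<open>W 0 = 0\<close> only almost surely. Hence the passage to the increment from time 0 and
  the separate case \<open>\<tau> = 0\<close>.\<close>

lemma standard_BM_integral:
  fixes f :: "real \<Rightarrow> real"
  assumes W: "standard_BM M W" and "0 \<le> \<tau>" and [measurable]: "f \<in> borel_measurable borel"
  shows "(LINT \<omega>|M. f (W \<tau> \<omega>)) = (LINT z|std_normal_distribution. f (sqrt \<tau> * z))"
proof -
  interpret prob_space M using W by (simp add: standard_BM_def)
  interpret N: real_distribution std_normal_distribution by (rule real_dist_normal_dist)
  have W0: "AE \<omega> in M. W 0 \<omega> = 0" and meas: "\<And>t. 0 \<le> t \<Longrightarrow> W t \<in> borel_measurable M"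
    using W by (auto simp: standard_BM_def)
  have [measurable]: "W \<tau> \<in> borel_measurable M" "W 0 \<in> borel_measurable M"
    using meas assms by auto
  show ?thesis
  proof (cases "\<tau> = 0")
    case True
    have "(LINT \<omega>|M. f (W \<tau> \<omega>)) = (LINT \<omega>|M. f 0)"
      using W0 True by (intro integral_cong_AE) (auto elim: eventually_mono)
    also have "\<dots> = (LINT z|std_normal_distribution. f 0)"
      unfolding lebesgue_integral_const using prob_space N.prob_space by simp
    finally show ?thesis using True by simp
  next
    case False
    then have \<tau>: "0 < \<tau>" "0 < sqrt \<tau>" using assms by auto
    have "distributed M lborel (\<lambda>\<omega>. W \<tau> \<omega> - W 0 \<omega>) (normal_density 0 (sqrt \<tau>))"
      using W \<tau>(1) by (rule standard_BM_distributed)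
    then have d: "distributed M lborel (\<lambda>\<omega>. (W \<tau> \<omega> - W 0 \<omega>) / sqrt \<tau>) std_normal_density"
      using normal_standard_normal_convert[OF \<tau>(2), of "\<lambda>\<omega>. W \<tau> \<omega> - W 0 \<omega>" 0] by simp
    have "(LINT \<omega>|M. f (W \<tau> \<omega>)) = (LINT \<omega>|M. f (sqrt \<tau> * ((W \<tau> \<omega> - W 0 \<omega>) / sqrt \<tau>)))"
      using W0 \<tau> by (intro integral_cong_AE) (auto elim: eventually_mono)
    also have "\<dots> = (LINT z|lborel. std_normal_density z * f (sqrt \<tau> * z))"
      using distributed_integral[OF d, of "\<lambda>z. f (sqrt \<tau> * z)"] by simp
    also have "\<dots> = (LINT z|std_normal_distribution. f (sqrt \<tau> * z))"
      by (subst integral_density) auto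
    finally show ?thesis .
  qed
qed

lemma bs_price_eq_bs_value:
  assumes "standard_BM M W" "t \<le> T"
  shows "bs_price M W \<sigma> r T K t = bs_value \<sigma> r K (T - t)"
proof
  fix x
  let ?f = "\<lambda>w. put K (x * exp ((r - \<sigma>\<^sup>2 / 2) * (T - t) + \<sigma> * w))"
  have "bs_price M W \<sigma> r T K t x = exp (- r * (T - t)) * (LINT \<omega>|M. ?f (W (T - t) \<omega>))"
    by (simp add: bs_price_def)
  also have "(LINT \<omega>|M. ?f (W (T - t) \<omega>)) = (LINT z|std_normal_distribution. ?f (sqrt (T - t) * z))"
    using assms by (intro standard_BM_integral) auto
  also have "\<dots> = (\<integral>l. put K (x * exp l) \<partial>bs_log_law \<sigma> r (T - t))"
    unfolding bs_log_law_def by (subst integral_distr) (simp_all add: mult.assoc)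
  finally show "bs_price M W \<sigma> r T K t x = bs_value \<sigma> r K (T - t) x"
    by (simp add: bs_value_def divide_inverse exp_minus[symmetric] algebra_simps)
qed

lemma bs_delta_eq_bs_slope:
  assumes "standard_BM M W" "t \<le> T" "0 < \<sigma>" "0 < x" "0 < K" "t < T \<or> x \<noteq> K"
  shows "bs_delta M W \<sigma> r T K t x = bs_slope \<sigma> r K (T - t) x"
proof -
  have "deriv (bs_price M W \<sigma> r T K t) x = bs_slope \<sigma> r K (T - t) x"
    unfolding bs_price_eq_bs_value[OF assms(1,2)]
    using assms by (intro DERIV_imp_deriv bs_value_has_derivative) auto
  then show ?thesis using assms by (auto simp: bs_delta_def)
qed

lemma P_disc_log_law:
  assumes q: "q_up \<mu> \<sigma> r m \<in> {0..1}" and ud: "0 < up \<mu> \<sigma> m" "0 < down \<mu> \<sigma> m"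
  shows "P_disc \<mu> \<sigma> r T K m k y =
    (\<integral>l. put K (y * exp l) \<partial>log_law \<mu> \<sigma> r m (steps T m - k)) / rate r m ^ (steps T m - k)"
proof -
  have "exp (real i * ln (up \<mu> \<sigma> m) + real l * ln (down \<mu> \<sigma> m)) = up \<mu> \<sigma> m ^ i * down \<mu> \<sigma> m ^ l" for i l
    using ud by (simp add: exp_add exp_of_nat_mult)
  then show ?thesis
    unfolding P_disc_def F_disc_expectation[OF q refl] log_law_def
    by (subst integral_distr) simp_all
qed

lemma rate_power_tendsto:
  assumes m: "filterlim m at_top sequentially" and j: "(\<lambda>i. real (j i) / 2 ^ (2 * m i)) \<longlonglongrightarrow> \<tau>" and "0 < r"
  shows "(\<lambda>i. rate r (m i) ^ j i) \<longlonglongrightarrow> exp (r * \<tau>)"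
proof -
  have "(\<lambda>n. 2 ^ (2 * n) * ln (1 + r / 2 ^ (2 * n))) \<longlonglongrightarrow> r" by real_asymp
  from tendsto_mult[OF j filterlim_compose[OF this m]]
  have "(\<lambda>i. exp (real (j i) * ln (rate r (m i)))) \<longlonglongrightarrow> exp (\<tau> * r)"
    by (intro tendsto_exp) (simp add: rate_def)
  moreover have "exp (real (j i) * ln (rate r (m i))) = rate r (m i) ^ j i" for i
    using rate_ge_1[of r "m i"] \<open>0 < r\<close> by (simp add: exp_of_nat_mult)
  ultimately show ?thesis by (simp add: mult.commute)
qed

section \<open>Discrete price and portfolio along sequences of grid points\<close>

context
  fixes \<mu> \<sigma> r T K \<tau> x :: real and m k :: "nat \<Rightarrow> nat" and xs :: "nat \<Rightarrow> real"
  assumes pos: "0 < \<sigma>" "0 < r" "0 < K" "0 < x" "0 \<le> \<tau>"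
    and m: "filterlim m at_top sequentially"
    and j: "(\<lambda>i. real (steps T (m i) - Suc (k i)) / 2 ^ (2 * m i)) \<longlonglongrightarrow> \<tau>"
    and xs: "xs \<longlonglongrightarrow> x"
begin

lemma up_down_tendsto:
  "(\<lambda>i. up \<mu> \<sigma> (m i) * xs i) \<longlonglongrightarrow> x" "(\<lambda>i. down \<mu> \<sigma> (m i) * xs i) \<longlonglongrightarrow> x"
  using tendsto_mult[OF filterlim_compose[OF LIMSEQ_up m] xs]
    tendsto_mult[OF filterlim_compose[OF LIMSEQ_down m] xs] by simp_all

lemma eventually_P_disc_log_law:
  "eventually (\<lambda>i. \<forall>y. P_disc \<mu> \<sigma> r T K (m i) (Suc (k i)) y =
     (\<integral>l. put K (y * exp l) \<partial>log_law \<mu> \<sigma> r (m i) (steps T (m i) - Suc (k i)))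
       / rate r (m i) ^ (steps T (m i) - Suc (k i))) sequentially"
proof -
  have "eventually (\<lambda>i. q_up \<mu> \<sigma> r (m i) \<in> {0..1}) sequentially"
    using eventually_q_up[OF pos(1)] m by (rule eventually_compose_filterlim)
  moreover have "eventually (\<lambda>i. 0 < up \<mu> \<sigma> (m i)) sequentially" "eventually (\<lambda>i. 0 < down \<mu> \<sigma> (m i)) sequentially"
    by (intro order_tendstoD(1)[OF filterlim_compose[OF LIMSEQ_up m]]
       order_tendstoD(1)[OF filterlim_compose[OF LIMSEQ_down m]] zero_less_one)+
  ultimately show ?thesis by eventually_elim (intro allI P_disc_log_law)
qed

lemma P_disc_tendsto:
  assumes ys: "ys \<longlonglongrightarrow> x"
  shows "(\<lambda>i. P_disc \<mu> \<sigma> r T K (m i) (Suc (k i)) (ys i)) \<longlonglongrightarrow> bs_value \<sigma> r K \<tau> x"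
proof -
  have "(\<lambda>i. (\<integral>l. put K (ys i * exp l) \<partial>log_law \<mu> \<sigma> r (m i) (steps T (m i) - Suc (k i)))
       / rate r (m i) ^ (steps T (m i) - Suc (k i))) \<longlonglongrightarrow> bs_value \<sigma> r K \<tau> x"
    unfolding bs_value_def
    by (intro tendsto_divide integral_put_tendsto real_distribution_log_law real_distribution_bs_log_law
      weak_conv_log_law pos m j ys rate_power_tendsto exp_not_eq_zero)
  then show ?thesis
    by (rule Lim_transform_eventually)
       (rule eventually_mono[OF eventually_P_disc_log_law], simp)
qed

text \<open>No derivative of the discrete price appears: the nodes \<open>down * xs i\<close> and
  \<open>up * xs i\<close> both move to \<open>x\<close>, and the quotient over this shrinking
  interval is passed to the limit directly.\<close>

lemma a_disc_tendsto:
  assumes ne: "0 < \<tau> \<or> x \<noteq> K"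
  shows "(\<lambda>i. a_disc \<mu> \<sigma> r T K (m i) (k i) (xs i)) \<longlonglongrightarrow> bs_slope \<sigma> r K \<tau> x"
proof -
  let ?L = "\<lambda>i. log_law \<mu> \<sigma> r (m i) (steps T (m i) - Suc (k i))"
  let ?u = "\<lambda>i. up \<mu> \<sigma> (m i) * xs i" and ?d = "\<lambda>i. down \<mu> \<sigma> (m i) * xs i"
  have ud: "?u i - ?d i = 2 * \<sigma> / 2 ^ m i * xs i" for i
    by (simp only: up_minus_down flip: left_diff_distrib)
  have "eventually (\<lambda>i. ?d i \<noteq> ?u i) sequentially"
    using order_tendstoD(1)[OF xs pos(4)]
  proof eventually_elim
    case (elim i)
    then have "0 < 2 * \<sigma> / 2 ^ m i * xs i" using pos(1) by simp
    then show ?case using ud[of i] by linarith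
  qed
  then have "(\<lambda>i. ((\<integral>l. put K (?u i * exp l) \<partial>?L i) - (\<integral>l. put K (?d i * exp l) \<partial>?L i)) / (?u i - ?d i)
      / rate r (m i) ^ (steps T (m i) - Suc (k i)))
    \<longlonglongrightarrow> bs_slope \<sigma> r K \<tau> x"
    unfolding bs_slope_def
    by (intro tendsto_divide integral_put_slope_tendsto real_distribution_log_law real_distribution_bs_log_law
      weak_conv_log_law pos m j up_down_tendsto rate_power_tendsto exp_not_eq_zero AE_bs_log_law_neq ne)
  then show ?thesis
  proof (rule Lim_transform_eventually)
    show "eventually (\<lambda>i. ((\<integral>l. put K (?u i * exp l) \<partial>?L i) - (\<integral>l. put K (?d i * exp l) \<partial>?L i)) / (?u i - ?d i)
      / rate r (m i) ^ (steps T (m i) - Suc (k i)) = a_disc \<mu> \<sigma> r T K (m i) (k i) (xs i)) sequentially"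
      using eventually_P_disc_log_law
    proof eventually_elim
      case (elim i)
      show ?case
        unfolding a_disc_def diff_quot_def elim[rule_format] left_diff_distrib
        by (simp add: diff_divide_distrib mult.commute)
    qed
  qed
qed

lemma b_disc_tendsto:
  assumes ne: "0 < \<tau> \<or> x \<noteq> K" and k: "(\<lambda>i. real (Suc (k i)) / 2 ^ (2 * m i)) \<longlonglongrightarrow> t"
  shows "(\<lambda>i. b_disc \<mu> \<sigma> r T K (m i) (k i) (xs i))
    \<longlonglongrightarrow> (bs_value \<sigma> r K \<tau> x - bs_slope \<sigma> r K \<tau> x * x) / exp (r * t)"
  unfolding b_disc_def
  by (intro tendsto_divide tendsto_diff tendsto_mult[OF a_disc_tendsto[OF ne]] P_disc_tendsto
      up_down_tendsto rate_power_tendsto[OF m k pos(2)] exp_not_eq_zero)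

end

section \<open>Convergence along a path\<close>

text \<open>The twist only flips signs, whatever values the stopping times and the index picked by
  \<open>THE\<close> take, so the paths on which a stopping time is meaningless need no separate
  treatment.\<close>

lemma twisted_sign:
  assumes "\<And>m k. 1 \<le> k \<Longrightarrow> x m k = 1 \<or> x m k = - 1" "1 \<le> n"
  shows "twisted x m n = 1 \<or> twisted x m n = - 1"
proof (cases m)
  case (Suc m')
  then show ?thesis using assms(1)[OF assms(2), of m] by (auto simp: Let_def)
qed (use assms in simp)

lemma BM_approx_grid: "BM_approx x m (grid m k) = walk (twisted x m) k / 2 ^ m"
  by (simp add: BM_approx_def grid_def lin_interp_def)

lemma BM_approx_grid_Suc:
  "BM_approx x m (grid m (Suc k)) = BM_approx x m (grid m k) + twisted x m (Suc k) / 2 ^ m"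
  by (simp add: BM_approx_grid walk_def add_divide_distrib)

text \<open>To second order in \<open>2^-m\<close>, the logarithm of a price factor is plus or minus
  \<open>\<sigma> * 2^-m\<close>, plus \<open>(\<mu> - \<sigma>^2/2) * 4^-m\<close>. This is the
  larger of the two remainders.\<close>

definition log_error :: "real \<Rightarrow> real \<Rightarrow> nat \<Rightarrow> real" where
  "log_error \<mu> \<sigma> m =
     max \<bar>ln (up \<mu> \<sigma> m) - ((\<mu> - \<sigma>\<^sup>2 / 2) / 2 ^ (2 * m) + \<sigma> / 2 ^ m)\<bar>
         \<bar>ln (down \<mu> \<sigma> m) - ((\<mu> - \<sigma>\<^sup>2 / 2) / 2 ^ (2 * m) - \<sigma> / 2 ^ m)\<bar>"

lemma log_error_tendsto: "0 < \<sigma> \<Longrightarrow> (\<lambda>m. log_error \<mu> \<sigma> m * 2 ^ (2 * m)) \<longlonglongrightarrow> 0"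
proof -
  assume \<sigma>: "0 < \<sigma>"
  have e: "filterlim (\<lambda>m. 1 / 2 ^ m :: real) (at_right 0) sequentially"
    by real_asymp
  have sq: "(1 / 2 ^ m)\<^sup>2 = (1 / 2 ^ (2 * m) :: real)" for m
    by (simp add: power_double_eq_square power_divide)
  have "((\<lambda>e. (ln (1 + \<sigma> * e + \<mu> * e\<^sup>2) - ((\<mu> - \<sigma>\<^sup>2 / 2) * e\<^sup>2 + \<sigma> * e)) / e\<^sup>2) \<longlongrightarrow> 0) (at_right 0)"
    "((\<lambda>e. (ln (1 - \<sigma> * e + \<mu> * e\<^sup>2) - ((\<mu> - \<sigma>\<^sup>2 / 2) * e\<^sup>2 - \<sigma> * e)) / e\<^sup>2) \<longlongrightarrow> 0) (at_right 0)"
    using \<sigma> by (real_asymp simp: field_simps power2_eq_square)+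
  note filterlim_compose[OF this(1) e] filterlim_compose[OF this(2) e]
  then have "(\<lambda>m. max \<bar>(ln (up \<mu> \<sigma> m) - ((\<mu> - \<sigma>\<^sup>2 / 2) / 2 ^ (2 * m) + \<sigma> / 2 ^ m)) * 2 ^ (2 * m)\<bar>
      \<bar>(ln (down \<mu> \<sigma> m) - ((\<mu> - \<sigma>\<^sup>2 / 2) / 2 ^ (2 * m) - \<sigma> / 2 ^ m)) * 2 ^ (2 * m)\<bar>) \<longlonglongrightarrow> max \<bar>0\<bar> \<bar>0\<bar>"
    unfolding sq by (intro tendsto_max tendsto_rabs) (simp_all add: up_def down_def)
  moreover have "max \<bar>a * c\<bar> \<bar>b * c\<bar> = max \<bar>a\<bar> \<bar>b\<bar> * c" if "0 \<le> c" for a b c :: real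
    using that by (simp add: abs_mult max_mult_distrib_right)
  ultimately show ?thesis by (simp add: log_error_def)
qed

text \<open>Each step is an up or a down factor, so the logarithmic errors add up at most linearly,
  whatever the signs. With at most \<open>T * 4^m\<close> steps and an \<open>o(4^-m)\<close>
  remainder for each, the total vanishes in the limit.\<close>

lemma stock_log_error:
  assumes x: "\<And>m k. 1 \<le> k \<Longrightarrow> x m k = 1 \<or> x m k = - 1"
    and ud: "0 < up \<mu> \<sigma> m" "0 < down \<mu> \<sigma> m"
  shows "\<exists>E. \<bar>E\<bar> \<le> real k * log_error \<mu> \<sigma> m
    \<and> stock \<mu> \<sigma> s0 x m k =
        s0 * exp ((\<mu> - \<sigma>\<^sup>2 / 2) * grid m k + \<sigma> * BM_approx x m (grid m k) + E)"
proof (induction k)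
  case 0
  have "BM_approx x m (grid m 0) = 0" by (simp only: BM_approx_grid) (simp add: walk_def)
  then show ?case by (intro exI[of _ 0]) (simp add: grid_def)
next
  case (Suc k)
  then obtain E where E: "\<bar>E\<bar> \<le> real k * log_error \<mu> \<sigma> m"
    "stock \<mu> \<sigma> s0 x m k = s0 * exp ((\<mu> - \<sigma>\<^sup>2 / 2) * grid m k + \<sigma> * BM_approx x m (grid m k) + E)"
    by blast
  define \<epsilon> where "\<epsilon> = twisted x m (Suc k)"
  define f where "f = 1 + \<mu> / 2 ^ (2 * m) + \<sigma> * (\<epsilon> / 2 ^ m)"
  have \<epsilon>: "\<epsilon> = 1 \<or> \<epsilon> = - 1" unfolding \<epsilon>_def by (rule twisted_sign[OF x]) simp_all
  then have f: "\<epsilon> = 1 \<and> f = up \<mu> \<sigma> m \<or> \<epsilon> = - 1 \<and> f = down \<mu> \<sigma> m"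
    by (auto simp: f_def up_def down_def)
  then have f0: "0 < f" using ud by auto
  define E' where "E' = ln f - ((\<mu> - \<sigma>\<^sup>2 / 2) / 2 ^ (2 * m) + \<sigma> * (\<epsilon> / 2 ^ m))"
  have "\<bar>E'\<bar> \<le> log_error \<mu> \<sigma> m"
    using f by (auto simp: E'_def log_error_def)
  then have "\<bar>E + E'\<bar> \<le> real (Suc k) * log_error \<mu> \<sigma> m"
    using E(1) by (simp add: algebra_simps)
  moreover have "stock \<mu> \<sigma> s0 x m (Suc k) = stock \<mu> \<sigma> s0 x m k * f"
    by (simp add: BM_approx_grid_Suc f_def \<epsilon>_def)
  moreover have "(\<mu> - \<sigma>\<^sup>2 / 2) * grid m (Suc k) + \<sigma> * BM_approx x m (grid m (Suc k)) + (E + E')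
     = ((\<mu> - \<sigma>\<^sup>2 / 2) * grid m k + \<sigma> * BM_approx x m (grid m k) + E) + ln f"
    unfolding BM_approx_grid_Suc \<epsilon>_def[symmetric] E'_def
    by (simp add: grid_def field_simps)
  moreover have "s0 * exp A * f = s0 * exp (A + ln f)" for A
    using f0 by (simp add: exp_add)
  ultimately show ?case
    unfolding E(2) by (intro exI[of _ "E + E'"] conjI) (assumption, simp only:)
qed

lemma steps_bounds:
  assumes "0 \<le> t"
  shows "real (steps t m) \<le> t * 2 ^ (2 * m)" "t * 2 ^ (2 * m) < real (steps t m) + 1"
proof -
  have "0 \<le> t * 2 ^ (2 * m)" using assms by simp
  then show "real (steps t m) \<le> t * 2 ^ (2 * m)" "t * 2 ^ (2 * m) < real (steps t m) + 1"
    unfolding steps_def by linarith+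
qed

lemma steps_abs_bounds:
  assumes "0 \<le> t"
  shows "\<bar>real (steps t m) - t * 2 ^ (2 * m)\<bar> \<le> 1" "\<bar>real (Suc (steps t m)) - t * 2 ^ (2 * m)\<bar> \<le> 1"
  using steps_bounds[OF assms, of m] unfolding abs_le_iff of_nat_Suc by linarith+

lemma divide_power4_tendsto:
  fixes ts a :: "nat \<Rightarrow> real"
  assumes m: "filterlim m at_top sequentially" and t: "ts \<longlonglongrightarrow> t"
    and bound: "\<And>i. \<bar>a i - ts i * 2 ^ (2 * m i)\<bar> \<le> C"
  shows "(\<lambda>i. a i / 2 ^ (2 * m i)) \<longlonglongrightarrow> t"
proof -
  have "(\<lambda>i. a i / 2 ^ (2 * m i) - ts i) \<longlonglongrightarrow> 0"
  proof (rule Lim_null_comparison)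
    have "(\<lambda>n. C / 2 ^ (2 * n)) \<longlonglongrightarrow> 0" by real_asymp
    from filterlim_compose[OF this m] show "(\<lambda>i. C / 2 ^ (2 * m i)) \<longlonglongrightarrow> 0" .
    have "norm (a i / 2 ^ (2 * m i) - ts i) \<le> C / 2 ^ (2 * m i)" for i
    proof -
      have "a i / 2 ^ (2 * m i) - ts i = (a i - ts i * 2 ^ (2 * m i)) / 2 ^ (2 * m i)"
        by (simp add: diff_divide_distrib)
      then show ?thesis using bound[of i] by (simp add: divide_right_mono)
    qed
    then show "eventually (\<lambda>i. norm (a i / 2 ^ (2 * m i) - ts i) \<le> C / 2 ^ (2 * m i)) sequentially"
      by simp
  qed
  from tendsto_add[OF this t] show ?thesis by simp
qed

text \<open>Rounding and the shift by one step change the count by at most 2. Truncation to 0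
  matters only if \<open>t\<close> and \<open>T\<close> fall into the same grid cell, where
  \<open>T - t\<close> is less than one step.\<close>

lemma steps_diff_bound:
  assumes "0 \<le> t" "t \<le> T"
  shows "\<bar>real (steps T m - Suc (steps t m)) - (T - t) * 2 ^ (2 * m)\<bar> \<le> 2"
proof -
  have "t * 2 ^ (2 * m) \<le> T * 2 ^ (2 * m)" using assms by simp
  moreover have "0 \<le> T" using assms by simp
  moreover have "real (steps T m - Suc (steps t m)) =
      (if Suc (steps t m) \<le> steps T m then real (steps T m) - real (steps t m) - 1 else 0)"
    by auto
  moreover have "\<not> Suc (steps t m) \<le> steps T m \<Longrightarrow> real (steps T m) \<le> real (steps t m)" by simp
  ultimately show ?thesis
    using steps_bounds[of t m] steps_bounds[of T m] assms unfolding left_diff_distrib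
    by (auto split: if_splits)
qed

text \<open>Sequential compactness reduces uniform convergence on \<open>[0, T]\<close> to convergence along
  arbitrary sequences of times.\<close>

lemma SUP_tendsto_0_if_sequences:
  fixes D :: "nat \<Rightarrow> real \<Rightarrow> real"
  assumes T: "0 \<le> T"
    and conv: "\<And>m ts t. filterlim m at_top sequentially \<Longrightarrow> (\<And>i. ts i \<in> {0..T}) \<Longrightarrow> t \<in> {0..T} \<Longrightarrow>
      ts \<longlonglongrightarrow> t \<Longrightarrow> (\<lambda>i. D (m i) (ts i)) \<longlonglongrightarrow> 0"
  shows "(\<lambda>m. SUP t\<in>{0..T}. ereal \<bar>D m t\<bar>) \<longlonglongrightarrow> 0"
proof -
  have ev: "eventually (\<lambda>m. \<forall>t\<in>{0..T}. \<bar>D m t\<bar> \<le> e) sequentially" if e: "0 < e" for e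
  proof (rule ccontr)
    assume "\<not> eventually (\<lambda>m. \<forall>t\<in>{0..T}. \<bar>D m t\<bar> \<le> e) sequentially"
    \<comment> \<open>The levels found need not increase, but \<open>n \<le> m n\<close> already
      sends them to infinity; only the times require a convergent subsequence.\<close>
    then have "\<forall>n. \<exists>m t. n \<le> m \<and> t \<in> {0..T} \<and> e < \<bar>D m t\<bar>"
      unfolding eventually_sequentially by (meson not_le)
    then obtain m ts where mt: "\<And>n. n \<le> m n" "\<And>n. ts n \<in> {0..T}" "\<And>n. e < \<bar>D (m n) (ts n)\<bar>"
      by metis
    obtain t \<rho> where t: "t \<in> {0..T}" "strict_mono \<rho>" "(ts \<circ> \<rho>) \<longlonglongrightarrow> t"
      using compact_Icc[of 0 T] mt(2) unfolding compact_eq_seq_compact_metric seq_compact_def by metis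
    have "filterlim m at_top sequentially"
      using mt(1) by (intro filterlim_at_top_mono[OF filterlim_ident]) auto
    then have m: "filterlim (\<lambda>i. m (\<rho> i)) at_top sequentially"
      by (rule filterlim_compose) (rule filterlim_subseq[OF t(2)])
    have "(\<lambda>i. D (m (\<rho> i)) ((ts \<circ> \<rho>) i)) \<longlonglongrightarrow> 0"
      by (rule conv[OF m _ t(1,3)]) (use mt(2) in simp)
    then have "(\<lambda>i. \<bar>D (m (\<rho> i)) (ts (\<rho> i))\<bar>) \<longlonglongrightarrow> 0" by (simp add: tendsto_rabs_zero)
    then have "eventually (\<lambda>i. \<bar>D (m (\<rho> i)) (ts (\<rho> i))\<bar> < e) sequentially"
      using e by (rule order_tendstoD(2))
    then obtain i where "\<bar>D (m (\<rho> i)) (ts (\<rho> i))\<bar> < e"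
      unfolding eventually_sequentially by blast
    with mt(3)[of "\<rho> i"] show False by simp
  qed
  show ?thesis
  \<comment> \<open>In \<open>ereal\<close> the supremum exists without a bound on
    \<open>D m\<close>; it may be infinite for finitely many \<open>m\<close>.\<close>
  proof (rule order_tendstoI)
    fix a :: ereal assume a: "a < 0"
    have "0 \<le> (SUP t\<in>{0..T}. ereal \<bar>D m t\<bar>)" for m
      using T by (intro SUP_upper2[of 0]) auto
    then show "eventually (\<lambda>m. a < (SUP t\<in>{0..T}. ereal \<bar>D m t\<bar>)) sequentially"
      using a by (intro always_eventually allI) (rule less_le_trans)
  next
    fix a :: ereal assume a: "0 < a"
    then obtain e where e: "0 < ereal e" "ereal e < a" using ereal_dense2 by blast
    have "eventually (\<lambda>m. \<forall>t\<in>{0..T}. \<bar>D m t\<bar> \<le> e) sequentially" using e by (intro ev) simp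
    then show "eventually (\<lambda>m. (SUP t\<in>{0..T}. ereal \<bar>D m t\<bar>) < a) sequentially"
    proof eventually_elim
      case (elim m)
      have "(SUP t\<in>{0..T}. ereal \<bar>D m t\<bar>) \<le> ereal e" using elim by (intro SUP_least) simp
      then show ?case using e(2) by (rule le_less_trans)
    qed
  qed
qed

section \<open>A single path with the almost sure properties\<close>

context
  fixes x :: "nat \<Rightarrow> nat \<Rightarrow> real" and b :: "real \<Rightarrow> real" and \<mu> \<sigma> r s0 T K :: real
    and M' :: "'b measure" and W :: "real \<Rightarrow> 'b \<Rightarrow> real"
  assumes sign: "\<And>m k. 1 \<le> k \<Longrightarrow> x m k = 1 \<or> x m k = - 1"
    and lim: "uniform_limit {0..T} (BM_approx x) b sequentially"
    and cont: "continuous_on {0..T} b"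
    and pos: "0 < \<sigma>" "0 < r" "0 < s0" "0 < T" "0 < K"
    and terminal: "bs_stock \<mu> \<sigma> s0 b T \<noteq> K"
    and W: "standard_BM M' W"
begin

context
  fixes m :: "nat \<Rightarrow> nat" and ts :: "nat \<Rightarrow> real" and t :: real
  assumes m: "filterlim m at_top sequentially"
    and ts: "\<And>i. ts i \<in> {0..T}" "t \<in> {0..T}" "ts \<longlonglongrightarrow> t"
begin

lemma steps_tendsto: "(\<lambda>i. real (steps (ts i) (m i)) / 2 ^ (2 * m i)) \<longlonglongrightarrow> t"
  by (rule divide_power4_tendsto[OF m ts(3), where C = 1])
     (rule steps_abs_bounds(1), use ts(1) in simp)

lemma Suc_steps_tendsto: "(\<lambda>i. real (Suc (steps (ts i) (m i))) / 2 ^ (2 * m i)) \<longlonglongrightarrow> t"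
  by (rule divide_power4_tendsto[OF m ts(3), where C = 1])
     (rule steps_abs_bounds(2), use ts(1) in simp)

lemma remaining_steps_tendsto:
  "(\<lambda>i. real (steps T (m i) - Suc (steps (ts i) (m i))) / 2 ^ (2 * m i)) \<longlonglongrightarrow> T - t"
  by (rule divide_power4_tendsto[OF m tendsto_diff[OF tendsto_const ts(3)], where C = 2])
     (use steps_diff_bound ts(1) in auto)

lemma bs_stock_tendsto: "(\<lambda>i. bs_stock \<mu> \<sigma> s0 b (ts i)) \<longlonglongrightarrow> bs_stock \<mu> \<sigma> s0 b t"
proof -
  have "(\<lambda>i. b (ts i)) \<longlonglongrightarrow> b t"
    by (rule continuous_on_tendsto_compose[OF cont ts(3,2)]) (use ts(1) in auto)
  then show ?thesis unfolding bs_stock_def by (intro tendsto_intros ts(3))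
qed

lemma stock_tendsto: "(\<lambda>i. stock \<mu> \<sigma> s0 x (m i) (steps (ts i) (m i))) \<longlonglongrightarrow> bs_stock \<mu> \<sigma> s0 b t"
proof -
  let ?g = "\<lambda>i. grid (m i) (steps (ts i) (m i))"
  have g: "?g \<longlonglongrightarrow> t" using steps_tendsto by (simp add: grid_def)
  \<comment> \<open>Rounding down keeps the grid times in the interval on which the limit is
    uniform, and uniformity permits evaluation at moving times.\<close>
  have gT: "?g i \<in> {0..T}" for i
  proof -
    have "?g i \<le> ts i" using steps_bounds(1)[of "ts i" "m i"] ts(1)[of i] by (simp add: grid_def pos_divide_le_eq)
    then show ?thesis using ts(1)[of i] by (simp add: grid_def)
  qed
  have "(\<lambda>i. BM_approx x (m i) (?g i) - b (?g i)) \<longlonglongrightarrow> 0"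
  proof (rule tendstoI)
    fix e :: real assume "0 < e"
    then have "eventually (\<lambda>n. \<forall>s\<in>{0..T}. dist (BM_approx x n s) (b s) < e) sequentially"
      using lim by (simp add: uniform_limit_iff)
    then have "eventually (\<lambda>i. \<forall>s\<in>{0..T}. dist (BM_approx x (m i) s) (b s) < e) sequentially"
      using m by (rule eventually_compose_filterlim)
    then show "eventually (\<lambda>i. dist (BM_approx x (m i) (?g i) - b (?g i)) 0 < e) sequentially"
      by eventually_elim (use gT in \<open>auto simp: dist_real_def\<close>)
  qed
  moreover have "(\<lambda>i. b (?g i)) \<longlonglongrightarrow> b t"
    by (rule continuous_on_tendsto_compose[OF cont g ts(2)]) (use gT in auto)
  ultimately have "(\<lambda>i. BM_approx x (m i) (?g i) - b (?g i) + b (?g i)) \<longlonglongrightarrow> 0 + b t"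
    by (rule tendsto_add)
  then have B: "(\<lambda>i. BM_approx x (m i) (?g i)) \<longlonglongrightarrow> b t" by simp
  let ?P = "\<lambda>i E. \<bar>E\<bar> \<le> real (steps (ts i) (m i)) * log_error \<mu> \<sigma> (m i) \<and>
     stock \<mu> \<sigma> s0 x (m i) (steps (ts i) (m i)) =
       s0 * exp ((\<mu> - \<sigma>\<^sup>2 / 2) * ?g i + \<sigma> * BM_approx x (m i) (?g i) + E)"
  \<comment> \<open>\<open>stock_log_error\<close> provides such an error term once
    \<open>up\<close> and \<open>down\<close> are positive, so the choice is meaningful for large
    \<open>i\<close>.\<close>
  define E where "E = (\<lambda>i. SOME e. ?P i e)"
  have "eventually (\<lambda>i. 0 < up \<mu> \<sigma> (m i)) sequentially" "eventually (\<lambda>i. 0 < down \<mu> \<sigma> (m i)) sequentially"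
    by (intro order_tendstoD(1)[OF filterlim_compose[OF LIMSEQ_up m]]
       order_tendstoD(1)[OF filterlim_compose[OF LIMSEQ_down m]] zero_less_one)+
  then have P: "eventually (\<lambda>i. ?P i (E i)) sequentially"
  proof eventually_elim
    case (elim i)
    show ?case unfolding E_def by (rule someI_ex[OF stock_log_error[OF sign elim]])
  qed
  have "E \<longlonglongrightarrow> 0"
  proof (rule Lim_null_comparison)
    show "eventually (\<lambda>i. norm (E i) \<le> real (steps (ts i) (m i)) / 2 ^ (2 * m i) *
       (log_error \<mu> \<sigma> (m i) * 2 ^ (2 * m i))) sequentially"
      using P by eventually_elim simp
    show "(\<lambda>i. real (steps (ts i) (m i)) / 2 ^ (2 * m i) * (log_error \<mu> \<sigma> (m i) * 2 ^ (2 * m i))) \<longlonglongrightarrow> 0"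
      using tendsto_mult[OF steps_tendsto filterlim_compose[OF log_error_tendsto[OF pos(1)] m]] by simp
  qed
  then have "(\<lambda>i. s0 * exp ((\<mu> - \<sigma>\<^sup>2 / 2) * ?g i + \<sigma> * BM_approx x (m i) (?g i) + E i))
     \<longlonglongrightarrow> s0 * exp ((\<mu> - \<sigma>\<^sup>2 / 2) * t + \<sigma> * b t + 0)"
    by (intro tendsto_intros g B)
  then have "(\<lambda>i. s0 * exp ((\<mu> - \<sigma>\<^sup>2 / 2) * ?g i + \<sigma> * BM_approx x (m i) (?g i) + E i))
     \<longlonglongrightarrow> bs_stock \<mu> \<sigma> s0 b t"
    by (simp add: bs_stock_def)
  then show ?thesis
    by (rule Lim_transform_eventually) (use P in \<open>eventually_elim, simp\<close>)
qed

lemma bs_stock_pos: "0 < bs_stock \<mu> \<sigma> s0 b s"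
  using pos by (simp add: bs_stock_def)

text \<open>Before maturity the price is differentiable at every positive argument, and at
  \<open>s = T\<close> the assumption \<open>terminal\<close> avoids the kink. The convention at the
  strike is thus never invoked.\<close>

lemma bs_delta_path_eq:
  assumes "s \<in> {0..T}"
  shows "bs_delta M' W \<sigma> r T K s (bs_stock \<mu> \<sigma> s0 b s) = bs_slope \<sigma> r K (T - s) (bs_stock \<mu> \<sigma> s0 b s)"
  using assms terminal by (intro bs_delta_eq_bs_slope W pos bs_stock_pos) auto

lemma nondegenerate: "0 < T - t \<or> bs_stock \<mu> \<sigma> s0 b t \<noteq> K"
  using ts(2) terminal by auto

lemma bs_slope_path_tendsto:
  "(\<lambda>i. bs_slope \<sigma> r K (T - ts i) (bs_stock \<mu> \<sigma> s0 b (ts i)))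
     \<longlonglongrightarrow> bs_slope \<sigma> r K (T - t) (bs_stock \<mu> \<sigma> s0 b t)"
  by (intro bs_slope_tendsto bs_stock_tendsto bs_stock_pos pos nondegenerate
      tendsto_diff tendsto_const ts(3)) (use ts(1) in auto)

text \<open>The discrete and the Black--Scholes ratio at \<open>ts i\<close> both tend to the slope
  at \<open>t\<close>, the first by joint convergence, the second by continuity of the slope along
  the path.\<close>

lemma a_path_tendsto:
  "(\<lambda>i. a_path \<mu> \<sigma> r s0 T K x (m i) (ts i) - bs_a M' W \<mu> \<sigma> r s0 T K b (ts i)) \<longlonglongrightarrow> 0"
proof -
  have "(\<lambda>i. a_path \<mu> \<sigma> r s0 T K x (m i) (ts i)) \<longlonglongrightarrow> bs_slope \<sigma> r K (T - t) (bs_stock \<mu> \<sigma> s0 b t)"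
    unfolding a_path_def using ts(2)
    by (intro a_disc_tendsto pos bs_stock_pos m remaining_steps_tendsto stock_tendsto nondegenerate) auto
  from tendsto_diff[OF this bs_slope_path_tendsto] show ?thesis
    using ts(1) by (simp add: bs_a_def bs_delta_path_eq)
qed

lemma b_path_tendsto:
  "(\<lambda>i. b_path \<mu> \<sigma> r s0 T K x (m i) (ts i) - bs_b M' W \<mu> \<sigma> r s0 T K b (ts i)) \<longlonglongrightarrow> 0"
proof -
  let ?S = "bs_stock \<mu> \<sigma> s0 b"
  have 1: "(\<lambda>i. b_path \<mu> \<sigma> r s0 T K x (m i) (ts i)) \<longlonglongrightarrow>
     (bs_value \<sigma> r K (T - t) (?S t) - bs_slope \<sigma> r K (T - t) (?S t) * ?S t) / exp (r * t)"
    unfolding b_path_def using ts(2)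
    by (intro b_disc_tendsto pos bs_stock_pos m remaining_steps_tendsto stock_tendsto nondegenerate
        Suc_steps_tendsto) auto
  have "(\<lambda>i. (bs_value \<sigma> r K (T - ts i) (?S (ts i)) - bs_slope \<sigma> r K (T - ts i) (?S (ts i)) * ?S (ts i)) / exp (r * ts i))
    \<longlonglongrightarrow> (bs_value \<sigma> r K (T - t) (?S t) - bs_slope \<sigma> r K (T - t) (?S t) * ?S t) / exp (r * t)"
    using ts(1)
    by (intro tendsto_divide tendsto_mult[OF bs_slope_path_tendsto bs_stock_tendsto] bs_value_tendsto
       tendsto_exp tendsto_mult[OF tendsto_const ts(3)] bs_stock_tendsto
       tendsto_diff tendsto_const ts(3) bs_stock_pos pos exp_not_eq_zero) auto
  moreover have "bs_b M' W \<mu> \<sigma> r s0 T K b (ts i) =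
     (bs_value \<sigma> r K (T - ts i) (?S (ts i)) - bs_slope \<sigma> r K (T - ts i) (?S (ts i)) * ?S (ts i)) / exp (r * ts i)" for i
    using ts(1)[of i] bs_price_eq_bs_value[OF W, of "ts i" T \<sigma> r K] bs_delta_path_eq[OF ts(1)[of i]]
    by (simp add: bs_b_def exp_minus field_simps)
  ultimately have "(\<lambda>i. bs_b M' W \<mu> \<sigma> r s0 T K b (ts i)) \<longlonglongrightarrow>
     (bs_value \<sigma> r K (T - t) (?S t) - bs_slope \<sigma> r K (T - t) (?S t) * ?S t) / exp (r * t)"
    by simp
  from tendsto_diff[OF 1 this] show ?thesis by simp
qed

end

lemma portfolio_path_converges:
  "(\<lambda>m. SUP t\<in>{0..T}. ereal \<bar>a_path \<mu> \<sigma> r s0 T K x m t - bs_a M' W \<mu> \<sigma> r s0 T K b t\<bar>) \<longlonglongrightarrow> 0"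
  "(\<lambda>m. SUP t\<in>{0..T}. ereal \<bar>b_path \<mu> \<sigma> r s0 T K x m t - bs_b M' W \<mu> \<sigma> r s0 T K b t\<bar>) \<longlonglongrightarrow> 0"
  using pos by (intro SUP_tendsto_0_if_sequences a_path_tendsto b_path_tendsto; simp)+

end

section \<open>Almost sure properties of the paths\<close>

lemma standard_BM_AE_neq:
  assumes B: "standard_BM M B" and "0 < T"
  shows "AE \<omega> in M. B T \<omega> \<noteq> w"
proof -
  have B0: "AE \<omega> in M. B 0 \<omega> = 0"
    using B by (simp add: standard_BM_def)
  have d: "distributed M lborel (\<lambda>\<omega>. B T \<omega> - B 0 \<omega>) (normal_density 0 (sqrt T))"
    by (rule standard_BM_distributed[OF assms])
  have "AE y in density lborel (normal_density 0 (sqrt T)). y \<noteq> w"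
    using AE_lborel_singleton[of w] by (subst AE_density) (auto elim: eventually_mono)
  then have "AE y in distr M lborel (\<lambda>\<omega>. B T \<omega> - B 0 \<omega>). y \<noteq> w"
    unfolding distributed_distr_eq_density[OF d] .
  then have "AE \<omega> in M. B T \<omega> - B 0 \<omega> \<noteq> w"
    by (rule AE_distrD[OF distributed_measurable[OF d]])
  with B0 show ?thesis by eventually_elim simp
qed

lemma (in prob_space) AE_fair_sign:
  assumes "prob {\<omega> \<in> space M. Y \<omega> = (1::real)} = 1 / 2" "prob {\<omega> \<in> space M. Y \<omega> = - 1} = 1 / 2"
  shows "AE \<omega> in M. Y \<omega> = 1 \<or> Y \<omega> = - 1"
proof -
  let ?A = "{\<omega> \<in> space M. Y \<omega> = 1}" and ?B = "{\<omega> \<in> space M. Y \<omega> = - 1}"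
  \<comment> \<open>Measurability is implied by the probabilities: \<open>measure\<close> assigns 0,
    not 1/2, to a nonmeasurable set.\<close>
  have sets: "?A \<in> sets M" "?B \<in> sets M"
    using assms measure_notin_sets by fastforce+
  then have "prob (?A \<union> ?B) = 1"
    using assms by (subst finite_measure_Union) auto
  then have "AE \<omega> in M. \<omega> \<in> ?A \<union> ?B" using sets by (subst AE_in_set_eq_1) auto
  then show ?thesis by eventually_elim auto
qed

theorem theorem3:
  fixes M :: "'a measure" and X :: "nat \<Rightarrow> nat \<Rightarrow> 'a \<Rightarrow> real" and B :: "real \<Rightarrow> 'a \<Rightarrow> real"
    and M' :: "'b measure" and W :: "real \<Rightarrow> 'b \<Rightarrow> real"
    and \<mu> \<sigma> r s0 T K :: real
  assumes "prob_space M" and "complete_measure M"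
    and "prob_space.indep_vars M (\<lambda>_. borel) (\<lambda>(m, k). X m k) (UNIV \<times> {1..})"
    and "\<And>m k. 1 \<le> k \<Longrightarrow> measure M {\<omega> \<in> space M. X m k \<omega> = 1} = 1 / 2"
    and "\<And>m k. 1 \<le> k \<Longrightarrow> measure M {\<omega> \<in> space M. X m k \<omega> = - 1} = 1 / 2"
    and "standard_BM M B"
    and "AE \<omega> in M. \<forall>R. uniform_limit {0..R}
           (\<lambda>m t. BM_approx (\<lambda>i j. X i j \<omega>) m t) (\<lambda>t. B t \<omega>) sequentially"
    and "standard_BM M' W"
    and "0 < \<sigma>" and "0 < r" and "0 < s0" and "0 < T" and "0 < K"
  shows "(\<forall>\<omega>\<in>space M. \<forall>c1 c3 c5 c6.
            is_c1 \<mu> \<sigma> s0 T (\<lambda>i j. X i j \<omega>) c1 \<and> is_c3 \<mu> \<sigma> r T c3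
              \<and> is_c5_c6 \<mu> \<sigma> r T K c1 c5 c6 \<longrightarrow>
            (\<forall>\<delta> m n k x.
               0 < \<delta> \<and> \<delta> \<le> T - grid m k \<and> 0 < x
                 \<and> m_zero \<mu> \<sigma> r \<le> real m \<and> 0 \<le> down \<mu> \<sigma> m
                 \<and> T = grid m (steps T m)
                 \<and> n = nat \<lceil>2 powr (2 * real m / 3)\<rceil>
                 \<and> 1 / K * (1 / real n + c1 / 2 ^ m) \<le> 1 / 2 \<longrightarrow>
               \<bar>a_disc \<mu> \<sigma> r T K m k x - deriv (P_smooth \<mu> \<sigma> r T K m n (Suc k)) x\<bar>
                 \<le> (2 * c3 * x + (c5 + c6) / (2 * \<sigma> * x * sqrt \<delta>)) * 2 powr (- real m / 3)
             \<and> \<bar>b_disc \<mu> \<sigma> r T K m k x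
                  - (P_disc \<mu> \<sigma> r T K m (Suc k) (up \<mu> \<sigma> m * x)
                     - up \<mu> \<sigma> m * x * deriv (P_smooth \<mu> \<sigma> r T K m n (Suc k)) x)
                    / rate r m ^ Suc k\<bar>
                 \<le> (1 + \<sigma> / 2 ^ m + \<bar>\<mu>\<bar> / 2 ^ (2 * m))
                   * (2 * c3 * x\<^sup>2 + (c5 + c6) / (2 * \<sigma> * sqrt \<delta>)) * 2 powr (- real m / 3)))
    \<and> (AE \<omega> in M.
         (\<lambda>m. SUP t\<in>{0..T}. ereal \<bar>a_path \<mu> \<sigma> r s0 T K (\<lambda>i j. X i j \<omega>) m t
                                 - bs_a M' W \<mu> \<sigma> r s0 T K (\<lambda>t. B t \<omega>) t\<bar>) \<longlonglongrightarrow> 0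
       \<and> (\<lambda>m. SUP t\<in>{0..T}. ereal \<bar>b_path \<mu> \<sigma> r s0 T K (\<lambda>i j. X i j \<omega>) m t
                                 - bs_b M' W \<mu> \<sigma> r s0 T K (\<lambda>t. B t \<omega>) t\<bar>) \<longlonglongrightarrow> 0)"
proof (intro conjI)
  show "\<forall>\<omega>\<in>space M. \<forall>c1 c3 c5 c6.
            is_c1 \<mu> \<sigma> s0 T (\<lambda>i j. X i j \<omega>) c1 \<and> is_c3 \<mu> \<sigma> r T c3
              \<and> is_c5_c6 \<mu> \<sigma> r T K c1 c5 c6 \<longrightarrow>
            (\<forall>\<delta> m n k x.
               0 < \<delta> \<and> \<delta> \<le> T - grid m k \<and> 0 < x
                 \<and> m_zero \<mu> \<sigma> r \<le> real m \<and> 0 \<le> down \<mu> \<sigma> m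
                 \<and> T = grid m (steps T m)
                 \<and> n = nat \<lceil>2 powr (2 * real m / 3)\<rceil>
                 \<and> 1 / K * (1 / real n + c1 / 2 ^ m) \<le> 1 / 2 \<longrightarrow>
               \<bar>a_disc \<mu> \<sigma> r T K m k x - deriv (P_smooth \<mu> \<sigma> r T K m n (Suc k)) x\<bar>
                 \<le> (2 * c3 * x + (c5 + c6) / (2 * \<sigma> * x * sqrt \<delta>)) * 2 powr (- real m / 3)
             \<and> \<bar>b_disc \<mu> \<sigma> r T K m k x
                  - (P_disc \<mu> \<sigma> r T K m (Suc k) (up \<mu> \<sigma> m * x)
                     - up \<mu> \<sigma> m * x * deriv (P_smooth \<mu> \<sigma> r T K m n (Suc k)) x)
                    / rate r m ^ Suc k\<bar>
                 \<le> (1 + \<sigma> / 2 ^ m + \<bar>\<mu>\<bar> / 2 ^ (2 * m))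
                   * (2 * c3 * x\<^sup>2 + (c5 + c6) / (2 * \<sigma> * sqrt \<delta>)) * 2 powr (- real m / 3))"
  proof (intro ballI allI impI)
    fix \<omega> and c1 c3 c5 c6 \<delta> x :: real and m n k :: nat
    assume c: "is_c1 \<mu> \<sigma> s0 T (\<lambda>i j. X i j \<omega>) c1 \<and> is_c3 \<mu> \<sigma> r T c3
              \<and> is_c5_c6 \<mu> \<sigma> r T K c1 c5 c6"
      and h: "0 < \<delta> \<and> \<delta> \<le> T - grid m k \<and> 0 < x
                 \<and> m_zero \<mu> \<sigma> r \<le> real m \<and> 0 \<le> down \<mu> \<sigma> m
                 \<and> T = grid m (steps T m)
                 \<and> n = nat \<lceil>2 powr (2 * real m / 3)\<rceil>
                 \<and> 1 / K * (1 / real n + c1 / 2 ^ m) \<le> 1 / 2"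
    have c1: "0 < c1" and c3: "is_c3 \<mu> \<sigma> r T c3" and c56: "is_c5_c6 \<mu> \<sigma> r T K c1 c5 c6"
      using c by (simp_all add: is_c1_def)
    from h have h: "0 < \<delta>" "\<delta> \<le> T - grid m k" "0 < x" "m_zero \<mu> \<sigma> r \<le> real m" "0 \<le> down \<mu> \<sigma> m"
      "T = grid m (steps T m)" "n = nat \<lceil>2 powr (2 * real m / 3)\<rceil>"
      "1 / K * (1 / real n + c1 / 2 ^ m) \<le> 1 / 2"
      by blast+
    note prems = assms(9,10,12,13) c1 h(3) c56 h(1,2,4-8) c3
    show "\<bar>a_disc \<mu> \<sigma> r T K m k x - deriv (P_smooth \<mu> \<sigma> r T K m n (Suc k)) x\<bar>
                 \<le> (2 * c3 * x + (c5 + c6) / (2 * \<sigma> * x * sqrt \<delta>)) * 2 powr (- real m / 3)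
             \<and> \<bar>b_disc \<mu> \<sigma> r T K m k x
                  - (P_disc \<mu> \<sigma> r T K m (Suc k) (up \<mu> \<sigma> m * x)
                     - up \<mu> \<sigma> m * x * deriv (P_smooth \<mu> \<sigma> r T K m n (Suc k)) x)
                    / rate r m ^ Suc k\<bar>
                 \<le> (1 + \<sigma> / 2 ^ m + \<bar>\<mu>\<bar> / 2 ^ (2 * m))
                   * (2 * c3 * x\<^sup>2 + (c5 + c6) / (2 * \<sigma> * sqrt \<delta>)) * 2 powr (- real m / 3)"
      by (rule conjI[OF a_disc_approx[OF prems] b_disc_approx[OF prems]])
  qed
  interpret prob_space M by (rule assms(1))
  have sign: "AE \<omega> in M. \<forall>m k. 1 \<le> k \<longrightarrow> X m k \<omega> = 1 \<or> X m k \<omega> = - 1"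
    unfolding AE_all_countable
  proof (intro allI)
    fix m k
    show "AE \<omega> in M. 1 \<le> k \<longrightarrow> X m k \<omega> = 1 \<or> X m k \<omega> = - 1"
    proof (cases "1 \<le> k")
      case True
      then show ?thesis using AE_fair_sign[of "X m k"] assms(4,5) by simp
    qed simp
  qed
  have terminal: "AE \<omega> in M. bs_stock \<mu> \<sigma> s0 (\<lambda>t. B t \<omega>) T \<noteq> K"
    \<comment> \<open>The final price is strictly increasing in \<open>B T\<close>, so it equals
      \<open>K\<close> for one value of \<open>B T\<close> only, the one inserted here.\<close>
    using standard_BM_AE_neq[OF assms(6) \<open>0 < T\<close>, of "(ln (K / s0) - (\<mu> - \<sigma>\<^sup>2 / 2) * T) / \<sigma>"]
  proof eventually_elim
    case (elim \<omega>)
    show ?case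
    proof
      assume "bs_stock \<mu> \<sigma> s0 (\<lambda>t. B t \<omega>) T = K"
      then have "exp ((\<mu> - \<sigma>\<^sup>2 / 2) * T + \<sigma> * B T \<omega>) = K / s0"
        using \<open>0 < s0\<close> by (simp add: bs_stock_def field_simps)
      then have "(\<mu> - \<sigma>\<^sup>2 / 2) * T + \<sigma> * B T \<omega> = ln (K / s0)" by (metis ln_exp)
      then show False using elim \<open>0 < \<sigma>\<close> by (simp add: field_simps)
    qed
  qed
  have cont: "AE \<omega> in M. continuous_on {0..} (\<lambda>t. B t \<omega>)"
    using assms(6) by (simp add: standard_BM_def)
  show "AE \<omega> in M.
         (\<lambda>m. SUP t\<in>{0..T}. ereal \<bar>a_path \<mu> \<sigma> r s0 T K (\<lambda>i j. X i j \<omega>) m t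
                                 - bs_a M' W \<mu> \<sigma> r s0 T K (\<lambda>t. B t \<omega>) t\<bar>) \<longlonglongrightarrow> 0
       \<and> (\<lambda>m. SUP t\<in>{0..T}. ereal \<bar>b_path \<mu> \<sigma> r s0 T K (\<lambda>i j. X i j \<omega>) m t
                                 - bs_b M' W \<mu> \<sigma> r s0 T K (\<lambda>t. B t \<omega>) t\<bar>) \<longlonglongrightarrow> 0"
    using sign terminal cont assms(7)
  proof eventually_elim
    case (elim \<omega>)
    have "continuous_on {0..T} (\<lambda>t. B t \<omega>)"
      using elim(3) by (rule continuous_on_subset) auto
    moreover have "uniform_limit {0..T} (BM_approx (\<lambda>i j. X i j \<omega>)) (\<lambda>t. B t \<omega>) sequentially"
      using elim(4) by simp
    ultimately show ?case
      using elim(1,2) assms(8-13) by (intro conjI portfolio_path_converges) auto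
  qed
qed

end
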